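(* Let $(X,\rho,\mu)$ be a space of homogeneous type (with the standing assumptions listed in the context), $q\in(1,\infty)$, and $\gamma\in[0,1)$. Assume that $\omega$ is a weight such that the parabolic maximal operator $\mathcal M^{\gamma+}$ (related to parabolic rectangles) is bounded from $L^q(X\times\mathbb R,\omega)$ to $L^{q,\infty}(X\times\mathbb R,\omega)$. Then $\omega\in A^+_q(\gamma)$.
   Context: Setting. $(X,\rho)$ is a quasi-metric space: $\rho:X\times X\to[0,\infty)$, $\rho(x,y)=0$ iff $x=y$, $\rho(x,y)=\rho(y,x)$, and $\rho(x,y)\le K_0[\rho(x,z)+\rho(z,y)]$ for all $x,y,z\in X$, with a constant $K_0\in[1,\infty)$. Balls are $B(x,r)=\{y\in X:\rho(x,y)<r\}$. $\mu$ is a nonnegative measure on a $\sigma$-algebra containing the balls which is doubling: $\mu(B(x,2r))\le C_\mu\mu(B(x,r))$ for all $x\in X$, $r\in(0,\infty)$; then $(X,\rho,\mu)$ is called a space of homogeneous type. Standing assumptions: (a) for each $x$ the balls $\{B(x,r)\}_{r>0}$ form a basis of open neighborhoods of $x$; (b) $\mu$ is Borel regular (open sets are measurable and every $A\subset X$ lies in a Borel set $E$ with $\mu(A)=\mu(E)$); (c) $0<\mu(B(x,r))<\infty$ for all balls; (d) $\operatorname{diam}(X)=\infty$ and $\mu(\{x\})=0$ for all $x$; (e) monotone geodesic property: there is a constant $\widetilde K>0$ such that for all $s\in(0,\infty)$ and $x,y\in X$ with $\rho(x,y)\ge s$ there are $m\in\mathbb N$ and points $x_0=x,x_1,\dots,x_m=y$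 with $\rho(x_i,x_{i+1})\le\widetilde K s$ and $\rho(x_{i+1},x_m)\le\rho(x_i,x_m)-s$ for $i=0,\dots,m-1$. Fix $p\in(1,\infty)$. $X\times\mathbb R$ carries the quasi-metric $d((x,t),(y,s))=\max\{\rho(x,y),|t-s|^{1/p}\}$ and the product measure $\lambda=\mu\times m$, $m$ being Lebesgue measure on $\mathbb R$; the same basic assumptions (a)-(d) are made for $(X\times\mathbb R,d,\lambda)$. All integrals are with respect to $\lambda$, and $⨍_E f:=\frac1{\lambda(E)}\int_E f$ denotes the average. Parabolic cylinders. For $x\in X$, $t\in\mathbb R$, $l\in(0,\infty)$, $\gamma\in[0,1)$ put $R=R(x,t,l)=B(x,l)\times(t-l^p,t+l^p)$, $R^-(\gamma)=B(x,l)\times(t-l^p,t-\gamma l^p)$, $R^+(\gamma)=B(x,l)\times(t+\gamma l^p,t+l^p)$. Weights. A weight is a real-valued, $\lambda$-almost everywhere positive, locally integrable function on $X\times\mathbb R$ (integrable on some cylinder $R(x,t,r)$ around each point). For $q\in(1,\infty)$, with $1/q+1/q'=1$, and $\gamma\in[0,1)$, a weight $\omega$ belongs to $A^+_q(\gamma)$ if $\sup_{R}\left[⨍_{R^-(\gamma)}\omega\right]\left[⨍_{R^+(\gamma)}\omega^{1-q'}\right]^{q-1}<\infty$, the supremum being over all parabolic cylinders $R(x,t,l)$. Adjacent dyadic systems and parabolic rectangles. Fix $\delta\in(0,1)$ with $96K_0^6\delta\le1$ and constants $0<c_0\le C_0<\infty$ with $12K_0^3C_0\delta\le c_0$; let $c_1=(3K_0^2)^{-1}c_0$,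 $C_1=2K_0C_0$. Fix (they exist by a theorem of Hytönen and Kairema) $K\in\mathbb N$ and, for $\tau\in\{1,\dots,K\}$, points $\{z^{k,\tau}_\alpha\}$ and families $\mathfrak D^\tau=\{Q^{k,\tau}_\alpha: k\in\mathbb Z,\alpha\in I_{k,\tau}\}$ of subsets of $X$ (dyadic cubes) such that for each $\tau$: $\rho(z^{k,\tau}_\alpha,z^{k,\tau}_\beta)\ge c_0\delta^k$ for $\alpha\ne\beta$ and $\min_\alpha\rho(x,z^{k,\tau}_\alpha)<C_0\delta^k$ for all $x\in X$; if $l\ge k$, then either $Q^{l,\tau}_\beta\subset Q^{k,\tau}_\alpha$ or they are disjoint; for each $k$, $X$ is the disjoint union of $Q^{k,\tau}_\alpha$, $\alpha\in I_{k,\tau}$; $B(z^{k,\tau}_\alpha,c_1\delta^k)\subset Q^{k,\tau}_\alpha\subset B(z^{k,\tau}_\alpha,C_1\delta^k)$; if $l\ge k$ and $Q^{l,\tau}_\beta\subset Q^{k,\tau}_\alpha$, then $B(z^{l,\tau}_\beta,C_1\delta^l)\subset B(z^{k,\tau}_\alpha,C_1\delta^k)$; moreover there is a constant $C_*>0$ such that every ball $B(x,r)$ is contained in some $Q^{k,\tau}_\alpha$ (for some $\tau$) with $\operatorname{diam}(Q^{k,\tau}_\alpha)\le C_*r$. A parabolic rectangle is $P=P(\tau,k,\alpha,t)=Q^{k,\tau}_\alpha\times(t-\delta^{kp},t+\delta^{kp})$, with $P^-(\gamma)=Q^{k,\tau}_\alpha\times(t-\delta^{kp},t-\gamma\delta^{kp})$,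 $P^+(\gamma)=Q^{k,\tau}_\alpha\times(t+\gamma\delta^{kp},t+\delta^{kp})$. Maximal function. For $f\in L^1_{\rm loc}(X\times\mathbb R)$, $\mathcal M^{\gamma+}f(x,t)=\sup ⨍_{P^+(\gamma)}|f|$, the supremum being over all $\tau,k,\alpha$ with $(x,t)\in P=P(\tau,k,\alpha,t)$ (i.e. $x\in Q^{k,\tau}_\alpha$; the same $t$). Spaces. $\|f\|_{L^q(X\times\mathbb R,\omega)}=(\int|f|^q\omega)^{1/q}$ and $\|f\|_{L^{q,\infty}(X\times\mathbb R,\omega)}=\sup_{\xi>0}\xi\,[\omega(\{|f|>\xi\})]^{1/q}$, where $\omega(E)=\int_E\omega$. *)

theory Defs
  imports "HOL-Analysis.Analysis"
begin

section \<open>Quasi-metric spaces\<close>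

text \<open>The space \<open>X\<close> is the whole type \<open>'a\<close>.\<close>

definition qball :: "('a \<Rightarrow> 'a \<Rightarrow> real) \<Rightarrow> 'a \<Rightarrow> real \<Rightarrow> 'a set" where
  "qball \<rho> x r = {y. \<rho> x y < r}"

definition qdiam :: "('a \<Rightarrow> 'a \<Rightarrow> real) \<Rightarrow> 'a set \<Rightarrow> ennreal" where
  "qdiam \<rho> A = (SUP x\<in>A. SUP y\<in>A. ennreal (\<rho> x y))"

text \<open>The topology induced by \<open>\<rho>\<close>. For a general quasi-metric the balls need not be open in it.\<close>

definition qopen :: "('a \<Rightarrow> 'a \<Rightarrow> real) \<Rightarrow> 'a set \<Rightarrow> bool" where
  "qopen \<rho> U \<longleftrightarrow> (\<forall>x\<in>U. \<exists>r>0. qball \<rho> x r \<subseteq> U)"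

definition qborel_sets :: "('a \<Rightarrow> 'a \<Rightarrow> real) \<Rightarrow> 'a set set" where
  "qborel_sets \<rho> = sigma_sets UNIV {U. qopen \<rho> U}"

locale quasi_metric =
  fixes \<rho> :: "'a \<Rightarrow> 'a \<Rightarrow> real" and K\<^sub>0 :: real
  assumes K0_ge_1: "1 \<le> K\<^sub>0"
    and nonneg: "0 \<le> \<rho> x y"
    and eq_0_iff: "\<rho> x y = 0 \<longleftrightarrow> x = y"
    and sym: "\<rho> x y = \<rho> y x"
    and quasi_triangle: "\<rho> x y \<le> K\<^sub>0 * (\<rho> x z + \<rho> z y)"

locale homogeneous_type = quasi_metric \<rho> K\<^sub>0
  for \<rho> :: "'a \<Rightarrow> 'a \<Rightarrow> real" and K\<^sub>0 :: real +
  fixes \<mu> :: "'a measure" and C\<^sub>\<mu> :: real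
  assumes space_eq: "space \<mu> = UNIV"
    and ball_measurable: "qball \<rho> x r \<in> sets \<mu>"
    and doubling: "0 < r \<Longrightarrow>
      emeasure \<mu> (qball \<rho> x (2 * r)) \<le> ennreal C\<^sub>\<mu> * emeasure \<mu> (qball \<rho> x r)"

text \<open>
  Borel regularity speaks of the measure of arbitrary subsets, i.e. of the outer measure,
  since \<^const>\<open>emeasure\<close> is \<open>0\<close> on non-measurable sets.
\<close>

locale standing_assumptions =
  fixes \<rho> :: "'a \<Rightarrow> 'a \<Rightarrow> real" and \<mu> :: "'a measure"
  assumes ball_open: "0 < r \<Longrightarrow> qopen \<rho> (qball \<rho> x r)"
    and open_measurable: "qopen \<rho> U \<Longrightarrow> U \<in> sets \<mu>"
    and borel_regular:
      "\<exists>E\<in>qborel_sets \<rho>. A \<subseteq> E \<and> outer_measure_of \<mu> A = emeasure \<mu> E"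
    and ball_pos: "0 < r \<Longrightarrow> 0 < emeasure \<mu> (qball \<rho> x r)"
    and ball_finite: "0 < r \<Longrightarrow> emeasure \<mu> (qball \<rho> x r) < \<infinity>"
    and diam_infinite: "qdiam \<rho> UNIV = \<infinity>"
    and point_null: "emeasure \<mu> {x} = 0"

definition monotone_geodesic :: "('a \<Rightarrow> 'a \<Rightarrow> real) \<Rightarrow> bool" where
  "monotone_geodesic \<rho> \<longleftrightarrow>
    (\<exists>K'>0. \<forall>s>0. \<forall>x y. s \<le> \<rho> x y \<longrightarrow>
      (\<exists>(m::nat) \<xi>. \<xi> 0 = x \<and> \<xi> m = y \<and>
        (\<forall>i<m. \<rho> (\<xi> i) (\<xi> (Suc i)) \<le> K' * s \<and>
               \<rho> (\<xi> (Suc i)) (\<xi> m) \<le> \<rho> (\<xi> i) (\<xi> m) - s)))"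


section \<open>The space \<open>X \<times> \<real>\<close>\<close>

definition par_dist :: "real \<Rightarrow> ('a \<Rightarrow> 'a \<Rightarrow> real) \<Rightarrow> 'a \<times> real \<Rightarrow> 'a \<times> real \<Rightarrow> real" where
  "par_dist p \<rho> = (\<lambda>(x, t) (y, s). max (\<rho> x y) (\<bar>t - s\<bar> powr (1 / p)))"

definition par_measure :: "'a measure \<Rightarrow> ('a \<times> real) measure" where
  "par_measure \<mu> = \<mu> \<Otimes>\<^sub>M (lebesgue :: real measure)"

definition cyl :: "('a \<Rightarrow> 'a \<Rightarrow> real) \<Rightarrow> real \<Rightarrow> 'a \<Rightarrow> real \<Rightarrow> real \<Rightarrow> ('a \<times> real) set" where
  "cyl \<rho> p x t l = qball \<rho> x l \<times> {t - l powr p <..< t + l powr p}"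

definition cyl_minus ::
    "('a \<Rightarrow> 'a \<Rightarrow> real) \<Rightarrow> real \<Rightarrow> real \<Rightarrow> 'a \<Rightarrow> real \<Rightarrow> real \<Rightarrow> ('a \<times> real) set" where
  "cyl_minus \<rho> p \<gamma> x t l = qball \<rho> x l \<times> {t - l powr p <..< t - \<gamma> * l powr p}"

definition cyl_plus ::
    "('a \<Rightarrow> 'a \<Rightarrow> real) \<Rightarrow> real \<Rightarrow> real \<Rightarrow> 'a \<Rightarrow> real \<Rightarrow> real \<Rightarrow> ('a \<times> real) set" where
  "cyl_plus \<rho> p \<gamma> x t l = qball \<rho> x l \<times> {t + \<gamma> * l powr p <..< t + l powr p}"


section \<open>Weights\<close>

text \<open>Powers with a positive exponent on \<open>[0, \<infinity>]\<close>.\<close>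

definition epowr :: "ennreal \<Rightarrow> real \<Rightarrow> ennreal" where
  "epowr u a = (if u = \<infinity> then \<infinity> else ennreal (enn2real u powr a))"

definition average :: "'b measure \<Rightarrow> 'b set \<Rightarrow> ('b \<Rightarrow> ennreal) \<Rightarrow> ennreal" where
  "average M E g = (\<integral>\<^sup>+z\<in>E. g z \<partial>M) / emeasure M E"

definition locally_integrable ::
    "('a \<Rightarrow> 'a \<Rightarrow> real) \<Rightarrow> 'a measure \<Rightarrow> real \<Rightarrow> ('a \<times> real \<Rightarrow> real) \<Rightarrow> bool" where
  "locally_integrable \<rho> \<mu> p f \<longleftrightarrow>
    f \<in> borel_measurable (par_measure \<mu>) \<and>
    (\<forall>x t. \<exists>r>0. set_integrable (par_measure \<mu>) (cyl \<rho> p x t r) f)"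

definition weight ::
    "('a \<Rightarrow> 'a \<Rightarrow> real) \<Rightarrow> 'a measure \<Rightarrow> real \<Rightarrow> ('a \<times> real \<Rightarrow> real) \<Rightarrow> bool" where
  "weight \<rho> \<mu> p \<omega> \<longleftrightarrow>
    locally_integrable \<rho> \<mu> p \<omega> \<and> (AE z in par_measure \<mu>. 0 < \<omega> z)"

definition conj_exponent :: "real \<Rightarrow> real" where
  "conj_exponent q = q / (q - 1)"

definition A_plus ::
    "('a \<Rightarrow> 'a \<Rightarrow> real) \<Rightarrow> 'a measure \<Rightarrow> real \<Rightarrow> real \<Rightarrow> real \<Rightarrow> ('a \<times> real \<Rightarrow> real) set" where
  "A_plus \<rho> \<mu> p q \<gamma> =
    {\<omega>. weight \<rho> \<mu> p \<omega> \<and>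
      (SUP x. SUP t. SUP l\<in>{0<..}.
         average (par_measure \<mu>) (cyl_minus \<rho> p \<gamma> x t l) (\<lambda>z. ennreal (\<omega> z)) *
         epowr (average (par_measure \<mu>) (cyl_plus \<rho> p \<gamma> x t l)
                  (\<lambda>z. ennreal (\<omega> z powr (1 - conj_exponent q)))) (q - 1)) < \<infinity>}"


section \<open>Adjacent dyadic systems and the parabolic maximal function\<close>

text \<open>
  \<open>z \<tau> k \<alpha>\<close> is the centre of the cube \<open>Q \<tau> k \<alpha>\<close>, and \<open>I \<tau> k\<close> indexes generation \<open>k\<close> of the
  system \<open>\<tau>\<close>. Measurability of the cubes (part of the construction of Hytonen and Kairema) is
  what makes averages over parabolic rectangles meaningful.
\<close>

locale adjacent_dyadic_systems =
  fixes \<rho> :: "'a \<Rightarrow> 'a \<Rightarrow> real" and \<mu> :: "'a measure"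
    and K\<^sub>0 \<delta> c\<^sub>0 C\<^sub>0 :: real and K :: nat
    and I :: "nat \<Rightarrow> int \<Rightarrow> 'i set"
    and z :: "nat \<Rightarrow> int \<Rightarrow> 'i \<Rightarrow> 'a"
    and Q :: "nat \<Rightarrow> int \<Rightarrow> 'i \<Rightarrow> 'a set"
  fixes c\<^sub>1 C\<^sub>1 :: real
  defines "c\<^sub>1 \<equiv> c\<^sub>0 / (3 * K\<^sub>0 ^ 2)" and "C\<^sub>1 \<equiv> 2 * K\<^sub>0 * C\<^sub>0"
  assumes delta: "0 < \<delta>" "\<delta> < 1" "96 * K\<^sub>0 ^ 6 * \<delta> \<le> 1"
    and constants: "0 < c\<^sub>0" "c\<^sub>0 \<le> C\<^sub>0" "12 * K\<^sub>0 ^ 3 * C\<^sub>0 * \<delta> \<le> c\<^sub>0"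
    and separated: "\<lbrakk>\<tau> \<in> {1..K}; \<alpha> \<in> I \<tau> k; \<beta> \<in> I \<tau> k; \<alpha> \<noteq> \<beta>\<rbrakk> \<Longrightarrow>
      c\<^sub>0 * \<delta> powi k \<le> \<rho> (z \<tau> k \<alpha>) (z \<tau> k \<beta>)"
    and dense: "\<tau> \<in> {1..K} \<Longrightarrow> \<exists>\<alpha>\<in>I \<tau> k. \<rho> x (z \<tau> k \<alpha>) < C\<^sub>0 * \<delta> powi k"
    and cube_measurable: "\<lbrakk>\<tau> \<in> {1..K}; \<alpha> \<in> I \<tau> k\<rbrakk> \<Longrightarrow> Q \<tau> k \<alpha> \<in> sets \<mu>"
    and nested: "\<lbrakk>\<tau> \<in> {1..K}; k \<le> l; \<alpha> \<in> I \<tau> k; \<beta> \<in> I \<tau> l\<rbrakk> \<Longrightarrow>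
      Q \<tau> l \<beta> \<subseteq> Q \<tau> k \<alpha> \<or> Q \<tau> l \<beta> \<inter> Q \<tau> k \<alpha> = {}"
    and partition: "\<tau> \<in> {1..K} \<Longrightarrow> (\<Union>\<alpha>\<in>I \<tau> k. Q \<tau> k \<alpha>) = UNIV"
      "\<tau> \<in> {1..K} \<Longrightarrow> disjoint_family_on (Q \<tau> k) (I \<tau> k)"
    and sandwich: "\<lbrakk>\<tau> \<in> {1..K}; \<alpha> \<in> I \<tau> k\<rbrakk> \<Longrightarrow> qball \<rho> (z \<tau> k \<alpha>) (c\<^sub>1 * \<delta> powi k) \<subseteq> Q \<tau> k \<alpha>"
      "\<lbrakk>\<tau> \<in> {1..K}; \<alpha> \<in> I \<tau> k\<rbrakk> \<Longrightarrow> Q \<tau> k \<alpha> \<subseteq> qball \<rho> (z \<tau> k \<alpha>) (C\<^sub>1 * \<delta> powi k)"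
    and nested_balls: "\<lbrakk>\<tau> \<in> {1..K}; k \<le> l; \<alpha> \<in> I \<tau> k; \<beta> \<in> I \<tau> l; Q \<tau> l \<beta> \<subseteq> Q \<tau> k \<alpha>\<rbrakk> \<Longrightarrow>
      qball \<rho> (z \<tau> l \<beta>) (C\<^sub>1 * \<delta> powi l) \<subseteq> qball \<rho> (z \<tau> k \<alpha>) (C\<^sub>1 * \<delta> powi k)"
    and adjacent: "\<exists>C'>0. \<forall>x r. 0 < r \<longrightarrow>
      (\<exists>\<tau>\<in>{1..K}. \<exists>k. \<exists>\<alpha>\<in>I \<tau> k. qball \<rho> x r \<subseteq> Q \<tau> k \<alpha> \<and> qdiam \<rho> (Q \<tau> k \<alpha>) \<le> ennreal (C' * r))"

definition rect_plus ::
    "real \<Rightarrow> real \<Rightarrow> (nat \<Rightarrow> int \<Rightarrow> 'i \<Rightarrow> 'a set) \<Rightarrow> real \<Rightarrow>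
     nat \<Rightarrow> int \<Rightarrow> 'i \<Rightarrow> real \<Rightarrow> ('a \<times> real) set" where
  "rect_plus p \<delta> Q \<gamma> \<tau> k \<alpha> t =
    Q \<tau> k \<alpha> \<times> {t + \<gamma> * \<delta> powr (real_of_int k * p) <..< t + \<delta> powr (real_of_int k * p)}"

text \<open>Since \<open>t\<close> is the time centre of the rectangle, \<open>(x, t) \<in> P(\<tau>, k, \<alpha>, t)\<close> just says \<open>x \<in> Q \<tau> k \<alpha>\<close>.\<close>

definition maximal_plus ::
    "'a measure \<Rightarrow> real \<Rightarrow> real \<Rightarrow> nat \<Rightarrow> (nat \<Rightarrow> int \<Rightarrow> 'i set) \<Rightarrow> (nat \<Rightarrow> int \<Rightarrow> 'i \<Rightarrow> 'a set) \<Rightarrow>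
     real \<Rightarrow> ('a \<times> real \<Rightarrow> real) \<Rightarrow> 'a \<times> real \<Rightarrow> ennreal" where
  "maximal_plus \<mu> p \<delta> K I Q \<gamma> f = (\<lambda>(x, t).
    SUP (\<tau>, k, \<alpha>) \<in> {(\<tau>, k, \<alpha>). \<tau> \<in> {1..K} \<and> \<alpha> \<in> I \<tau> k \<and> x \<in> Q \<tau> k \<alpha>}.
      average (par_measure \<mu>) (rect_plus p \<delta> Q \<gamma> \<tau> k \<alpha> t) (\<lambda>w. ennreal \<bar>f w\<bar>))"


section \<open>Weighted Lebesgue spaces\<close>

definition Lq_norm :: "'b measure \<Rightarrow> ('b \<Rightarrow> real) \<Rightarrow> real \<Rightarrow> ('b \<Rightarrow> real) \<Rightarrow> ennreal" where
  "Lq_norm M \<omega> q f = epowr (\<integral>\<^sup>+w. ennreal (\<bar>f w\<bar> powr q) * ennreal (\<omega> w) \<partial>M) (1 / q)"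

definition weighted_measure :: "'b measure \<Rightarrow> ('b \<Rightarrow> real) \<Rightarrow> 'b set \<Rightarrow> ennreal" where
  "weighted_measure M \<omega> E = (\<integral>\<^sup>+w\<in>E. ennreal (\<omega> w) \<partial>M)"

definition weak_Lq_norm :: "'b measure \<Rightarrow> ('b \<Rightarrow> real) \<Rightarrow> real \<Rightarrow> ('b \<Rightarrow> ennreal) \<Rightarrow> ennreal" where
  "weak_Lq_norm M \<omega> q g =
    (SUP \<xi>\<in>{0<..}. ennreal \<xi> * epowr (weighted_measure M \<omega> {w \<in> space M. ennreal \<xi> < g w}) (1 / q))"

text \<open>
  The maximal operator acts on locally integrable functions, so its boundedness is only required
  for locally integrable members of \<open>L\<^sup>q(\<omega>)\<close>.
\<close>

definition maximal_plus_weak_bounded ::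
    "('a \<Rightarrow> 'a \<Rightarrow> real) \<Rightarrow> 'a measure \<Rightarrow> real \<Rightarrow> real \<Rightarrow> nat \<Rightarrow> (nat \<Rightarrow> int \<Rightarrow> 'i set) \<Rightarrow>
     (nat \<Rightarrow> int \<Rightarrow> 'i \<Rightarrow> 'a set) \<Rightarrow> real \<Rightarrow> real \<Rightarrow> ('a \<times> real \<Rightarrow> real) \<Rightarrow> bool" where
  "maximal_plus_weak_bounded \<rho> \<mu> p \<delta> K I Q q \<gamma> \<omega> \<longleftrightarrow>
    (\<exists>C::real. 0 \<le> C \<and> (\<forall>f. locally_integrable \<rho> \<mu> p f \<longrightarrow> Lq_norm (par_measure \<mu>) \<omega> q f < \<infinity> \<longrightarrow>
      weak_Lq_norm (par_measure \<mu>) \<omega> q (maximal_plus \<mu> p \<delta> K I Q \<gamma> f)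
        \<le> ennreal C * Lq_norm (par_measure \<mu>) \<omega> q f))"

end

theory Submission
  imports Defs
begin

text \<open>
  Testing the weak type inequality on functions supported in a small set \<open>V\<close> bounds \<open>\<omega>(U)\<close> by
  a multiple of \<open>\<omega>(V)\<close>, and even gives the Muckenhoupt condition for the pair \<open>(U, V)\<close>, as long as
  the upper part of a parabolic rectangle centred at any point of \<open>U\<close> contains \<open>V\<close> and is not much
  larger. For \<open>\<gamma> = 0\<close> this applies directly to the two halves of a cylinder \<open>R(x, t, l)\<close>.
  For \<open>\<gamma> > 0\<close> the upper part starts too late for the rectangles that are large enough to contain
  the ball, so both halves are covered by boundedly many boxes of spatial radius \<open>\<epsilon> l\<close>, and a box
  of the lower half is connected with one of the upper half by a chain of boxes moving forward in
  time. The monotone geodesic property keeps the number of spatial steps of order \<open>1 / \<epsilon>\<close>; since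
  each takes time of order \<open>(\<epsilon> l)\<^sup>p\<close> and \<open>p > 1\<close>, the lag \<open>2 \<gamma> l\<^sup>p\<close> suffices.
\<close>

section \<open>Powers on the extended half-line\<close>

lemma epowr_ennreal: "0 \<le> x \<Longrightarrow> epowr (ennreal x) a = ennreal (x powr a)"
  by (simp add: epowr_def)

lemma epowr_le_iff:
  assumes "0 < a"
  shows "epowr u a \<le> v \<longleftrightarrow> u \<le> epowr v (1 / a)"
proof (cases u; cases v)
  fix r s assume rs: "u = ennreal r" "0 \<le> r" "v = ennreal s" "0 \<le> s"
  have "r powr a \<le> s \<longleftrightarrow> r \<le> s powr (1 / a)"
  proof
    assume "r powr a \<le> s"
    then have "(r powr a) powr (1 / a) \<le> s powr (1 / a)"
      using assms by (intro powr_mono2) auto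
    then show "r \<le> s powr (1 / a)" using rs assms by (simp add: powr_powr)
  next
    assume "r \<le> s powr (1 / a)"
    then have "r powr a \<le> (s powr (1 / a)) powr a"
      using assms rs by (intro powr_mono2) auto
    then show "r powr a \<le> s" using rs assms by (simp add: powr_powr)
  qed
  then show ?thesis using rs by (simp add: epowr_ennreal)
qed (use assms in \<open>auto simp: epowr_def top_unique\<close>)

lemma epowr_mono: "0 < a \<Longrightarrow> u \<le> v \<Longrightarrow> epowr u a \<le> epowr v a"
  by (metis epowr_le_iff order.refl order.trans)

lemma epowr_SUP:
  assumes "0 < a"
  shows "epowr (SUP i\<in>J. f i) a = (SUP i\<in>J. epowr (f i) a)"
proof (rule antisym)
  show "epowr (SUP i\<in>J. f i) a \<le> (SUP i\<in>J. epowr (f i) a)"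
    unfolding epowr_le_iff[OF assms]
    by (intro SUP_least) (metis SUP_upper epowr_le_iff[OF assms])
  show "(SUP i\<in>J. epowr (f i) a) \<le> epowr (SUP i\<in>J. f i) a"
    by (intro SUP_least epowr_mono[OF assms] SUP_upper)
qed

lemma epowr_mult:
  assumes "0 < a"
  shows "epowr (u * v) a = epowr u a * epowr v a"
proof (cases u; cases v)
  fix r s assume "u = ennreal r" "0 \<le> r" "v = ennreal s" "0 \<le> s"
  then show ?thesis
    by (simp add: epowr_ennreal powr_mult flip: ennreal_mult)
next
  fix r assume "u = ennreal r" "0 \<le> r" "v = top"
  then show ?thesis
    by (cases "r = 0") (auto simp: epowr_def ennreal_mult_top)
next
  fix r assume "v = ennreal r" "0 \<le> r" "u = top"
  then show ?thesis
    by (cases "r = 0") (auto simp: epowr_def ennreal_top_mult)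
qed (auto simp: epowr_def)


section \<open>Testing inequalities\<close>

text \<open>
  If the average of \<open>f\<close> over \<open>V\<close> is at least \<open>1\<close>, then a weak type inequality bounds \<open>\<omega>(U)\<close>
  whenever \<open>V\<close> is a substantial part of an admissible rectangle for every point of \<open>U\<close>.
  With the average normalised in this way, the condition is transitive with multiplicative
  constants (use \<open>f = 1\<close> in the first factor), and scaling \<open>f\<close> recovers the two-set
  Muckenhoupt condition.
\<close>

definition testing ::
    "'b measure \<Rightarrow> real \<Rightarrow> ('b \<Rightarrow> real) \<Rightarrow> real \<Rightarrow> 'b set \<Rightarrow> 'b set \<Rightarrow> bool" where
  "testing M q \<omega> C U V \<longleftrightarrow>
    (\<forall>f B. f \<in> borel_measurable M \<longrightarrow> (\<forall>w. 0 \<le> f w \<and> f w \<le> B) \<longrightarrow>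
       emeasure M V \<le> (\<integral>\<^sup>+w\<in>V. ennreal (f w) \<partial>M) \<longrightarrow>
       weighted_measure M \<omega> U \<le> ennreal C * (\<integral>\<^sup>+w\<in>V. ennreal (f w powr q) * ennreal (\<omega> w) \<partial>M))"

lemma testing_mono: "testing M q \<omega> C U V \<Longrightarrow> C \<le> D \<Longrightarrow> testing M q \<omega> D U V"
  unfolding testing_def by (meson ennreal_leI mult_right_mono order_trans zero_le)

lemma testing_weighted_measure:
  assumes "testing M q \<omega> C U V" "V \<in> sets M"
  shows "weighted_measure M \<omega> U \<le> ennreal C * weighted_measure M \<omega> V"
proof -
  have "emeasure M V \<le> (\<integral>\<^sup>+w\<in>V. ennreal 1 \<partial>M)"
    using assms(2) by simp
  then have "weighted_measure M \<omega> U \<le>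
      ennreal C * (\<integral>\<^sup>+w\<in>V. ennreal (1 powr q) * ennreal (\<omega> w) \<partial>M)"
    using assms(1)[unfolded testing_def, rule_format, of "\<lambda>_. 1" 1] by simp
  then show ?thesis by (simp add: weighted_measure_def)
qed

lemma testing_trans:
  assumes "testing M q \<omega> C U V" "testing M q \<omega> D V W" "V \<in> sets M" "0 \<le> C" "0 \<le> D"
  shows "testing M q \<omega> (C * D) U W"
  unfolding testing_def
proof (intro allI impI)
  fix f :: "_ \<Rightarrow> real" and B
  assume f: "f \<in> borel_measurable M" "\<forall>w. 0 \<le> f w \<and> f w \<le> B"
    "emeasure M W \<le> (\<integral>\<^sup>+w\<in>W. ennreal (f w) \<partial>M)"
  let ?F = "\<integral>\<^sup>+w\<in>W. ennreal (f w powr q) * ennreal (\<omega> w) \<partial>M"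
  have "weighted_measure M \<omega> U \<le> ennreal C * weighted_measure M \<omega> V"
    by (rule testing_weighted_measure[OF assms(1,3)])
  also have "\<dots> \<le> ennreal C * (ennreal D * ?F)"
    using assms(2) f unfolding testing_def by (intro mult_left_mono) auto
  also have "\<dots> = ennreal (C * D) * ?F"
    using assms by (simp add: ennreal_mult mult.assoc)
  finally show "weighted_measure M \<omega> U \<le> ennreal (C * D) * ?F" .
qed

lemma testing_chain:
  assumes "\<And>i. i < n \<Longrightarrow> testing M q \<omega> C (U i) (U (Suc i))" "\<And>i. U i \<in> sets M"
    "0 \<le> C" "0 < n"
  shows "testing M q \<omega> (C ^ n) (U 0) (U n)"
  using assms(4,1)
proof (induction n rule: nat_induct_non_zero)
  case 1
  then show ?case by simp
next
  case (Suc n)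
  then have "testing M q \<omega> (C ^ n * C) (U 0) (U (Suc n))"
    using assms(2,3) by (intro testing_trans[of M q \<omega> "C ^ n" "U 0" "U n" C]) auto
  then show ?case by (simp add: mult.commute)
qed

lemma conj_exponent_powr:
  assumes "1 < q" "0 < x"
  shows "(x powr (1 - conj_exponent q)) powr (q - 1) * x = 1"
proof -
  have "(1 - conj_exponent q) * (q - 1) = - 1"
    using assms by (simp add: conj_exponent_def field_simps)
  then show ?thesis
    using assms by (simp add: powr_powr powr_minus)
qed

lemma testing_dual:
  fixes \<omega> :: "'b \<Rightarrow> real"
  assumes test: "testing M q \<omega> C U V" and "1 < q" and C: "0 \<le> C"
    and V: "V \<in> sets M" "0 < emeasure M V" "emeasure M V < \<infinity>"
    and \<omega>: "\<omega> \<in> borel_measurable M" "AE w in M. 0 < \<omega> w"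
  shows "weighted_measure M \<omega> U *
      epowr (\<integral>\<^sup>+w\<in>V. ennreal (\<omega> w powr (1 - conj_exponent q)) \<partial>M) (q - 1)
    \<le> ennreal C * epowr (emeasure M V) q"
proof -
  let ?W = "weighted_measure M \<omega> U"
  define \<sigma> where "\<sigma> w = \<omega> w powr (1 - conj_exponent q)" for w
  define A where "A n = (\<integral>\<^sup>+w\<in>V. ennreal (min (\<sigma> w) (real (Suc n))) \<partial>M)" for n
  have \<sigma>_meas [measurable]: "\<sigma> \<in> borel_measurable M"
    unfolding \<sigma>_def using \<omega> by measurable
  note [measurable] = \<omega>(1) V(1)
  have \<sigma>_nonneg: "0 \<le> \<sigma> w" for w by (simp add: \<sigma>_def)
  obtain L where L: "emeasure M V = ennreal L" "0 < L"
    using V by (cases "emeasure M V") auto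
  have A_bound: "?W * epowr (A n) (q - 1) \<le> ennreal C * epowr (emeasure M V) q" for n
  proof -
    have "A n \<le> (\<integral>\<^sup>+w\<in>V. ennreal (real (Suc n)) \<partial>M)"
      unfolding A_def by (intro nn_integral_mono mult_right_mono ennreal_leI) auto
    also have "\<dots> < \<infinity>"
      using V by (subst nn_integral_cmult_indicator) (auto simp: ennreal_mult_less_top)
    finally have "A n < \<infinity>" .
    moreover have "A n \<noteq> 0"
    proof
      assume "A n = 0"
      then have "AE w in M. ennreal (min (\<sigma> w) (real (Suc n))) * indicator V w = 0"
        unfolding A_def by (subst (asm) nn_integral_0_iff_AE) auto
      with \<omega>(2) have "AE w in M. w \<notin> V"
        by eventually_elim (auto simp: \<sigma>_def min_def split: split_indicator_asm split: if_splits)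
      then have "V \<in> null_sets M" by (simp add: AE_iff_null_sets[OF V(1)])
      then show False using V(2) by (simp add: null_sets_def)
    qed
    ultimately obtain a where a: "A n = ennreal a" "0 < a"
      by (cases "A n") auto
    define c where "c = L / a"
    have c: "0 < c" using L a by (simp add: c_def)
    define f where "f w = c * min (\<sigma> w) (real (Suc n))" for w
    have "(\<integral>\<^sup>+w\<in>V. ennreal (f w) \<partial>M)
        = (\<integral>\<^sup>+w. ennreal c * (ennreal (min (\<sigma> w) (real (Suc n))) * indicator V w) \<partial>M)"
      using c \<sigma>_nonneg by (intro nn_integral_cong) (simp add: f_def ennreal_mult mult.assoc)
    also have "\<dots> = ennreal c * A n"
      unfolding A_def by (subst nn_integral_cmult) auto
    also have "\<dots> = emeasure M V"
      using a L c by (simp add: c_def flip: ennreal_mult)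
    finally have int_f: "(\<integral>\<^sup>+w\<in>V. ennreal (f w) \<partial>M) = emeasure M V" .
    have "?W \<le> ennreal C * (\<integral>\<^sup>+w\<in>V. ennreal (f w powr q) * ennreal (\<omega> w) \<partial>M)"
    proof (rule test[unfolded testing_def, rule_format, of f "c * real (Suc n)"])
      show "f \<in> borel_measurable M" unfolding f_def by measurable
      show "0 \<le> f w \<and> f w \<le> c * real (Suc n)" for w
        using c \<sigma>_nonneg[of w] by (simp add: f_def mult_left_mono)
    qed (simp add: int_f)
    also have "(\<integral>\<^sup>+w\<in>V. ennreal (f w powr q) * ennreal (\<omega> w) \<partial>M)
        \<le> (\<integral>\<^sup>+w. ennreal (c powr q) * (ennreal (min (\<sigma> w) (real (Suc n))) * indicator V w) \<partial>M)"
    proof (rule nn_integral_mono_AE)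
      show "AE w in M. ennreal (f w powr q) * ennreal (\<omega> w) * indicator V w
          \<le> ennreal (c powr q) * (ennreal (min (\<sigma> w) (real (Suc n))) * indicator V w)"
        using \<omega>(2)
      proof eventually_elim
        fix w assume w: "0 < \<omega> w"
        define m where "m = min (\<sigma> w) (real (Suc n))"
        have m: "0 < m" "m \<le> \<sigma> w" using w by (auto simp: m_def \<sigma>_def)
        have "m powr q * \<omega> w = m * (m powr (q - 1) * \<omega> w)"
          using m by (simp add: powr_diff)
        also have "\<dots> \<le> m * (\<sigma> w powr (q - 1) * \<omega> w)"
          using m w \<open>1 < q\<close> by (intro mult_left_mono mult_right_mono powr_mono2) auto
        also have "\<dots> = m"
          using conj_exponent_powr[OF \<open>1 < q\<close> w] by (simp add: \<sigma>_def)
        finally have "m powr q * \<omega> w \<le> m" .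
        moreover have "f w = c * m" by (simp add: f_def m_def)
        ultimately have "f w powr q * \<omega> w \<le> c powr q * m"
          using c m by (simp add: powr_mult mult.assoc)
        then show "ennreal (f w powr q) * ennreal (\<omega> w) * indicator V w
          \<le> ennreal (c powr q) * (ennreal (min (\<sigma> w) (real (Suc n))) * indicator V w)"
          using w m unfolding m_def[symmetric]
          by (auto split: split_indicator simp flip: ennreal_mult intro!: ennreal_leI)
      qed
    qed
    also have "\<dots> = ennreal (c powr q) * A n"
      unfolding A_def by (subst nn_integral_cmult) auto
    finally have "?W \<le> ennreal C * (ennreal (c powr q) * A n)"
      by (simp add: mult_left_mono)
    then have "?W * epowr (A n) (q - 1)
        \<le> ennreal C * (ennreal (c powr q) * A n) * epowr (A n) (q - 1)"
      by (rule mult_right_mono) simp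
    also have "\<dots> = ennreal C * ennreal (c powr q * a * a powr (q - 1))"
      using a c by (simp add: epowr_ennreal mult.assoc flip: ennreal_mult)
    also have "c powr q * a * a powr (q - 1) = L powr q"
      using a L by (simp add: c_def powr_divide powr_diff)
    also have "ennreal (L powr q) = epowr (emeasure M V) q"
      using L by (simp add: epowr_ennreal)
    finally show ?thesis .
  qed
  have "(\<integral>\<^sup>+w\<in>V. ennreal (\<sigma> w) \<partial>M) = (\<integral>\<^sup>+w. (SUP n. ennreal (min (\<sigma> w) (real (Suc n))) * indicator V w) \<partial>M)"
  proof (rule nn_integral_cong)
    fix w
    have "(SUP n. ennreal (min (\<sigma> w) (real (Suc n)))) = ennreal (\<sigma> w)"
    proof (rule antisym)
      obtain n where "\<sigma> w \<le> real (Suc n)"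
        using real_arch_simple[of "\<sigma> w"] by (metis le_SucI le_refl of_nat_mono order.trans)
      then have "ennreal (\<sigma> w) = ennreal (min (\<sigma> w) (real (Suc n)))" by simp
      then show "ennreal (\<sigma> w) \<le> (SUP n. ennreal (min (\<sigma> w) (real (Suc n))))"
        by (metis SUP_upper UNIV_I)
    qed (auto intro!: SUP_least ennreal_leI)
    then show "ennreal (\<sigma> w) * indicator V w = (SUP n. ennreal (min (\<sigma> w) (real (Suc n))) * indicator V w)"
      by (auto split: split_indicator)
  qed
  also have "\<dots> = (SUP n. A n)"
    unfolding A_def
    by (rule nn_integral_monotone_convergence_SUP)
      (auto simp: incseq_def le_fun_def intro!: mult_right_mono ennreal_leI)
  finally have "?W * epowr (\<integral>\<^sup>+w\<in>V. ennreal (\<sigma> w) \<partial>M) (q - 1) = (SUP n. ?W * epowr (A n) (q - 1))"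
    using \<open>1 < q\<close> by (simp add: epowr_SUP SUP_mult_left_ennreal)
  also have "\<dots> \<le> ennreal C * epowr (emeasure M V) q"
    by (rule SUP_least) (rule A_bound)
  finally show ?thesis by (simp add: \<sigma>_def)
qed


section \<open>Balls and dyadic cubes\<close>

lemma sigma_finite_lebesgue: "sigma_finite_measure (lebesgue :: real measure)"
proof
  show "\<exists>A. countable A \<and> A \<subseteq> sets (lebesgue :: real measure) \<and> \<Union>A = space lebesgue \<and>
      (\<forall>a\<in>A. emeasure lebesgue a \<noteq> \<infinity>)"
  proof (intro exI[of _ "range (\<lambda>n::nat. {- real n..real n})"] conjI ballI)
    show "\<Union>(range (\<lambda>n::nat. {- real n..real n})) = space lebesgue"
    proof (auto)
      fix x :: real
      obtain n where "\<bar>x\<bar> \<le> real n" using real_arch_simple by blast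
      then show "\<exists>n. - real n \<le> x \<and> x \<le> real n" by (intro exI[of _ n]) auto
    qed
  qed auto
qed

lemma par_measure_Times:
  "V \<in> sets \<mu> \<Longrightarrow> J \<in> sets lebesgue \<Longrightarrow> V \<times> J \<in> sets (par_measure \<mu>)"
  by (simp add: par_measure_def)

lemma emeasure_par_measure_Times:
  assumes "V \<in> sets \<mu>" "J \<in> sets lebesgue"
  shows "emeasure (par_measure \<mu>) (V \<times> J) = emeasure \<mu> V * emeasure lebesgue J"
  unfolding par_measure_def
  using sigma_finite_measure.emeasure_pair_measure_Times[OF sigma_finite_lebesgue assms] .

lemma powi_powr_powr: "0 < \<delta> \<Longrightarrow> \<delta> powr (real_of_int k * p) = (\<delta> powi k) powr p"
  by (simp add: powr_powr powr_real_of_int' flip: powr_powr)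

context homogeneous_type
begin

lemma qball_mono: "r \<le> s \<Longrightarrow> qball \<rho> x r \<subseteq> qball \<rho> x s"
  by (auto simp: qball_def)

lemma qball_shift:
  assumes "\<rho> y x \<le> s"
  shows "qball \<rho> x r \<subseteq> qball \<rho> y (K\<^sub>0 * (s + r))"
proof
  fix u assume "u \<in> qball \<rho> x r"
  then have "K\<^sub>0 * (\<rho> y x + \<rho> x u) < K\<^sub>0 * (s + r)"
    using assms K0_ge_1 by (auto simp: qball_def)
  then show "u \<in> qball \<rho> y (K\<^sub>0 * (s + r))"
    using quasi_triangle[of y u x] by (simp add: qball_def)
qed

lemma doubling_iterated:
  obtains D where "1 \<le> D"
    "\<And>x r. 0 < r \<Longrightarrow> emeasure \<mu> (qball \<rho> x (c * r)) \<le> ennreal D * emeasure \<mu> (qball \<rho> x r)"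
proof -
  define D where "D = max 1 C\<^sub>\<mu>"
  have D: "1 \<le> D" by (simp add: D_def)
  have step: "emeasure \<mu> (qball \<rho> x (2 ^ n * r)) \<le> ennreal (D ^ n) * emeasure \<mu> (qball \<rho> x r)"
    if "0 < r" for x r n
  proof (induction n)
    case (Suc n)
    have "emeasure \<mu> (qball \<rho> x (2 ^ Suc n * r)) \<le> ennreal C\<^sub>\<mu> * emeasure \<mu> (qball \<rho> x (2 ^ n * r))"
      using doubling[of "2 ^ n * r" x] that by (simp add: mult.assoc)
    also have "\<dots> \<le> ennreal D * (ennreal (D ^ n) * emeasure \<mu> (qball \<rho> x r))"
      by (intro mult_mono Suc ennreal_leI) (auto simp: D_def)
    finally show ?case using D by (simp add: ennreal_mult mult.assoc)
  qed simp
  obtain n where n: "c < 2 ^ n" using real_arch_pow[of 2 c] by auto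
  show thesis
  proof (rule that[of "D ^ n"])
    fix x and r :: real assume "0 < r"
    then have "emeasure \<mu> (qball \<rho> x (c * r)) \<le> emeasure \<mu> (qball \<rho> x (2 ^ n * r))"
      using n by (intro emeasure_mono qball_mono ball_measurable mult_right_mono) auto
    then show "emeasure \<mu> (qball \<rho> x (c * r)) \<le> ennreal (D ^ n) * emeasure \<mu> (qball \<rho> x r)"
      using step[OF \<open>0 < r\<close>, of x n] by (rule order.trans)
  qed (use D in simp)
qed

lemma monotone_geodesic_chain:
  assumes "monotone_geodesic \<rho>"
  obtains K' where "1 \<le> K'" "\<And>s x y. 0 < s \<Longrightarrow> s \<le> \<rho> x y \<Longrightarrow>
      \<exists>(m::nat) \<xi>. 0 < m \<and> real m * s \<le> \<rho> x y \<and> \<xi> 0 = x \<and> \<xi> m = y \<and>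
        (\<forall>i<m. \<rho> (\<xi> i) (\<xi> (Suc i)) \<le> K' * s)"
proof -
  obtain K' where K': "0 < K'" and geo: "\<forall>s>0. \<forall>x y. s \<le> \<rho> x y \<longrightarrow>
      (\<exists>(m::nat) \<xi>. \<xi> 0 = x \<and> \<xi> m = y \<and>
        (\<forall>i<m. \<rho> (\<xi> i) (\<xi> (Suc i)) \<le> K' * s \<and>
               \<rho> (\<xi> (Suc i)) (\<xi> m) \<le> \<rho> (\<xi> i) (\<xi> m) - s))"
    using assms(1) unfolding monotone_geodesic_def by (elim exE conjE)
  show thesis
  proof (rule that[of "max 1 K'"])
    fix s x y assume s: "0 < s" "s \<le> \<rho> x y"
    obtain m :: nat and \<xi> where \<xi>: "\<xi> 0 = x" "\<xi> m = y"
      and step: "\<forall>i<m. \<rho> (\<xi> i) (\<xi> (Suc i)) \<le> K' * s \<and>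
               \<rho> (\<xi> (Suc i)) (\<xi> m) \<le> \<rho> (\<xi> i) (\<xi> m) - s"
      using geo[rule_format, OF s] by (elim exE conjE)
    have "\<rho> (\<xi> i) (\<xi> m) \<le> \<rho> x y - real i * s" if "i \<le> m" for i
      using that
    proof (induction i)
      case (Suc i)
      then have "\<rho> (\<xi> (Suc i)) (\<xi> m) \<le> \<rho> (\<xi> i) (\<xi> m) - s" using step by simp
      with Suc show ?case by (simp add: algebra_simps)
    qed (simp add: \<xi>)
    from this[of m] have "real m * s \<le> \<rho> x y" using nonneg[of "\<xi> m" "\<xi> m"] by simp
    moreover have "0 < m" using s \<xi> eq_0_iff[of x x] by (cases "m = 0") auto
    ultimately show "\<exists>(m::nat) \<xi>. 0 < m \<and> real m * s \<le> \<rho> x y \<and> \<xi> 0 = x \<and> \<xi> m = y \<and>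
        (\<forall>i<m. \<rho> (\<xi> i) (\<xi> (Suc i)) \<le> max 1 K' * s)"
      using \<xi> step s mult_right_mono[of K' "max 1 K'" s]
      by (intro exI[of _ m] exI[of _ \<xi>]) (auto intro: order.trans)
  qed simp
qed

text \<open>
  Walking from a far away point to \<open>x\<close> along a monotone chain, the first point inside the ball
  cannot be much closer to \<open>x\<close> than \<open>r\<close>.
\<close>

lemma point_in_annulus:
  assumes "standing_assumptions \<rho> \<mu>" "monotone_geodesic \<rho>" "0 < r"
  obtains y where "r / (2 * K\<^sub>0) \<le> \<rho> x y" "\<rho> x y < r"
proof -
  have K0: "0 < K\<^sub>0" using K0_ge_1 by simp
  obtain K' where "1 \<le> K'" and geo: "\<And>s x y. 0 < s \<Longrightarrow> s \<le> \<rho> x y \<Longrightarrow>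
      \<exists>(m::nat) \<xi>. 0 < m \<and> real m * s \<le> \<rho> x y \<and> \<xi> 0 = x \<and> \<xi> m = y \<and>
        (\<forall>i<m. \<rho> (\<xi> i) (\<xi> (Suc i)) \<le> K' * s)"
    using monotone_geodesic_chain[OF assms(2)] by blast
  then have K': "0 < K'" by simp
  define s where "s = r / (2 * K\<^sub>0 * K')"
  have s: "0 < s" using assms K0 K' by (simp add: s_def)
  have "\<exists>u. max r s \<le> \<rho> u x"
  proof (rule ccontr)
    assume "\<nexists>u. max r s \<le> \<rho> u x"
    then have far: "\<rho> u x < max r s" for u by (meson not_less)
    have "\<rho> u v \<le> K\<^sub>0 * (max r s + max r s)" for u v
    proof -
      have "\<rho> u v \<le> K\<^sub>0 * (\<rho> u x + \<rho> x v)" by (rule quasi_triangle)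
      also have "\<dots> \<le> K\<^sub>0 * (max r s + max r s)"
        using far[of u] far[of v] K0 by (intro mult_left_mono add_mono) (auto simp: sym)
      finally show ?thesis .
    qed
    then have "qdiam \<rho> UNIV \<le> ennreal (K\<^sub>0 * (max r s + max r s))"
      unfolding qdiam_def by (intro SUP_least ennreal_leI)
    then show False
      using standing_assumptions.diam_infinite[OF assms(1)] by (simp add: top_unique)
  qed
  then obtain u where u: "max r s \<le> \<rho> u x" by blast
  then obtain m :: nat and \<xi> where \<xi>: "\<xi> 0 = u" "\<xi> m = x"
    "\<And>i. i < m \<Longrightarrow> \<rho> (\<xi> i) (\<xi> (Suc i)) \<le> K' * s"
    using geo[OF s, of u x] by auto
  define j where "j = (LEAST i. \<rho> (\<xi> i) x < r)"
  have "\<rho> (\<xi> m) x < r" using \<xi> assms(3) eq_0_iff[of x x] by simp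
  then have j: "\<rho> (\<xi> j) x < r" "j \<le> m"
    unfolding j_def by (auto intro: LeastI Least_le)
  have "j \<noteq> 0" using j(1) u \<xi>(1) by (intro notI) simp
  then obtain i where i: "j = Suc i" by (cases j) auto
  have "\<not> \<rho> (\<xi> i) x < r"
    using not_less_Least[of i "\<lambda>i. \<rho> (\<xi> i) x < r"] i by (simp add: j_def)
  then have "r \<le> K\<^sub>0 * (\<rho> (\<xi> i) (\<xi> j) + \<rho> (\<xi> j) x)"
    using quasi_triangle[of "\<xi> i" x "\<xi> j"] by simp
  also have "\<dots> \<le> K\<^sub>0 * (K' * s + \<rho> (\<xi> j) x)"
    using \<xi>(3)[of i] i j K0 by (intro mult_left_mono add_mono) auto
  also have "\<dots> = r / 2 + K\<^sub>0 * \<rho> (\<xi> j) x"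
    using K0 K' by (simp add: s_def field_simps)
  finally have "r / (2 * K\<^sub>0) \<le> \<rho> x (\<xi> j)"
    using K0 by (simp add: sym field_simps)
  then show thesis
    using j(1) that[of "\<xi> j"] by (simp add: sym)
qed

lemma ball_in_comparable_cube:
  assumes "standing_assumptions \<rho> \<mu>" "monotone_geodesic \<rho>"
    and "adjacent_dyadic_systems \<rho> \<mu> K\<^sub>0 \<delta> c\<^sub>0 C\<^sub>0 K I z Q"
  obtains a b C where "0 < a" "0 < b" "0 < C"
    "\<And>x r. 0 < r \<Longrightarrow> \<exists>\<tau>\<in>{1..K}. \<exists>k. \<exists>\<alpha>\<in>I \<tau> k. Q \<tau> k \<alpha> \<in> sets \<mu> \<and>
       qball \<rho> x r \<subseteq> Q \<tau> k \<alpha> \<and> Q \<tau> k \<alpha> \<subseteq> qball \<rho> x (C * r) \<and>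
       a * r \<le> \<delta> powi k \<and> \<delta> powi k \<le> b * r"
proof -
  define c1 where "c1 = c\<^sub>0 / (3 * K\<^sub>0 ^ 2)"
  define C1 where "C1 = 2 * K\<^sub>0 * C\<^sub>0"
  interpret D: adjacent_dyadic_systems \<rho> \<mu> K\<^sub>0 \<delta> c\<^sub>0 C\<^sub>0 K I z Q c1 C1
    using assms(3) by (auto simp: c1_def C1_def)
  obtain C' where C': "0 < C'" and adj: "\<And>x r. 0 < r \<Longrightarrow>
      \<exists>\<tau>\<in>{1..K}. \<exists>k. \<exists>\<alpha>\<in>I \<tau> k. qball \<rho> x r \<subseteq> Q \<tau> k \<alpha> \<and> qdiam \<rho> (Q \<tau> k \<alpha>) \<le> ennreal (C' * r)"
    using D.adjacent by auto
  have K0: "0 < K\<^sub>0" using K0_ge_1 by simp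
  have c1: "0 < c1" and C1: "0 < C1"
    using K0 D.constants by (auto simp: c1_def C1_def)
  define a where "a = 1 / (4 * K\<^sub>0\<^sup>2 * C1)"
  define b where "b = 2 * K\<^sub>0 * C' / c1"
  define C where "C = 2 * K\<^sub>0 * C1 * b"
  show thesis
  proof (rule that)
    show "0 < a" "0 < b" "0 < C" using K0 C1 c1 C' by (auto simp: a_def b_def C_def)
    fix x and r :: real assume r: "0 < r"
    obtain \<tau> k \<alpha> where Q: "\<tau> \<in> {1..K}" "\<alpha> \<in> I \<tau> k" "qball \<rho> x r \<subseteq> Q \<tau> k \<alpha>"
        "qdiam \<rho> (Q \<tau> k \<alpha>) \<le> ennreal (C' * r)"
      using adj[OF r, of x] by blast
    let ?Q = "Q \<tau> k \<alpha>" and ?z = "z \<tau> k \<alpha>" and ?d = "\<delta> powi k"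
    have d: "0 < ?d" using D.delta by simp
    have outer: "\<rho> ?z u < C1 * ?d" if "u \<in> ?Q" for u
      using D.sandwich(2)[OF Q(1,2)] that by (auto simp: qball_def)
    have inner: "u \<in> ?Q" if "\<rho> ?z u < c1 * ?d" for u
      using D.sandwich(1)[OF Q(1,2)] that by (auto simp: qball_def)
    have Q_diam: "\<rho> u v \<le> K\<^sub>0 * (C1 * ?d + C1 * ?d)" if "u \<in> ?Q" "v \<in> ?Q" for u v
    proof -
      have "\<rho> u v \<le> K\<^sub>0 * (\<rho> u ?z + \<rho> ?z v)" by (rule quasi_triangle)
      also have "\<dots> \<le> K\<^sub>0 * (C1 * ?d + C1 * ?d)"
        using outer[of u] outer[of v] that K0 by (intro mult_left_mono add_mono) (auto simp: sym)
      finally show ?thesis .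
    qed
    have x: "x \<in> ?Q" using Q(3) r eq_0_iff[of x x] by (auto simp: qball_def)
    have lower: "a * r \<le> ?d"
    proof -
      obtain y where y: "r / (2 * K\<^sub>0) \<le> \<rho> x y" "\<rho> x y < r"
        using point_in_annulus[OF assms(1,2) r] .
      have "y \<in> ?Q" using Q(3) y by (auto simp: qball_def)
      then have "r / (2 * K\<^sub>0) \<le> K\<^sub>0 * (C1 * ?d + C1 * ?d)"
        using Q_diam[OF x] y by fastforce
      then show ?thesis
        using K0 C1 by (simp add: a_def field_simps power2_eq_square)
    qed
    have upper: "?d \<le> b * r"
    proof -
      have cd: "0 < c1 * ?d" using c1 d by simp
      obtain y where y: "c1 * ?d / (2 * K\<^sub>0) \<le> \<rho> ?z y" "\<rho> ?z y < c1 * ?d"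
        using point_in_annulus[OF assms(1,2) cd] .
      have "y \<in> ?Q" "?z \<in> ?Q"
        using y cd eq_0_iff[of ?z ?z] by (auto intro: inner)
      then have "ennreal (\<rho> ?z y) \<le> qdiam \<rho> ?Q"
        unfolding qdiam_def by (intro SUP_upper2[of ?z] SUP_upper2[of y]) auto
      then have "ennreal (\<rho> ?z y) \<le> ennreal (C' * r)" using Q(4) by (rule order.trans)
      then have "\<rho> ?z y \<le> C' * r" using C' r by (subst (asm) ennreal_le_iff) auto
      then have "c1 * ?d / (2 * K\<^sub>0) \<le> C' * r" using y(1) by simp
      then show ?thesis
        using K0 c1 by (simp add: b_def field_simps)
    qed
    have "?Q \<subseteq> qball \<rho> x (C * r)"
    proof
      fix u assume "u \<in> ?Q"
      have "\<rho> x u \<le> K\<^sub>0 * (\<rho> x ?z + \<rho> ?z u)" by (rule quasi_triangle)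
      also have "\<dots> < K\<^sub>0 * (C1 * ?d + C1 * ?d)"
        using outer[OF x] outer[OF \<open>u \<in> ?Q\<close>] K0 by (intro mult_strict_left_mono add_strict_mono) (auto simp: sym)
      also have "\<dots> = 2 * K\<^sub>0 * C1 * ?d" by simp
      also have "\<dots> \<le> 2 * K\<^sub>0 * C1 * (b * r)"
        using upper K0 C1 by (intro mult_left_mono) auto
      finally show "u \<in> qball \<rho> x (C * r)" by (simp add: qball_def C_def mult.assoc)
    qed
    then show "\<exists>\<tau>\<in>{1..K}. \<exists>k. \<exists>\<alpha>\<in>I \<tau> k. Q \<tau> k \<alpha> \<in> sets \<mu> \<and>
       qball \<rho> x r \<subseteq> Q \<tau> k \<alpha> \<and> Q \<tau> k \<alpha> \<subseteq> qball \<rho> x (C * r) \<and>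
       a * r \<le> \<delta> powi k \<and> \<delta> powi k \<le> b * r"
      using Q lower upper D.cube_measurable by blast
  qed
qed

text \<open>Take a maximal \<open>\<epsilon> l\<close>-separated subset of the ball; doubling bounds its size.\<close>

lemma ball_finite_cover:
  assumes "standing_assumptions \<rho> \<mu>" "0 < \<epsilon>"
  obtains N :: nat where
    "\<And>x l. 0 < l \<Longrightarrow> \<exists>F\<subseteq>qball \<rho> x l. finite F \<and> card F \<le> N \<and>
       qball \<rho> x l \<subseteq> (\<Union>y\<in>F. qball \<rho> y (\<epsilon> * l))"
proof -
  interpret S: standing_assumptions \<rho> \<mu> by fact
  have K0: "0 < K\<^sub>0" using K0_ge_1 by simp
  define s where "s = \<epsilon> / (2 * K\<^sub>0)"
  have s: "0 < s" using assms K0 by (simp add: s_def)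
  define B where "B = K\<^sub>0 * (1 + s)"
  obtain D where D: "1 \<le> D"
    "\<And>x r. 0 < r \<Longrightarrow> emeasure \<mu> (qball \<rho> x ((K\<^sub>0 * (1 + B) / s) * r)) \<le> ennreal D * emeasure \<mu> (qball \<rho> x r)"
    using doubling_iterated by blast
  define N where "N = nat \<lceil>D\<rceil>"
  have card_le: "card F \<le> N"
    if l: "0 < l" and F: "finite F" "F \<subseteq> qball \<rho> x l"
      and sep: "\<And>u v. u \<in> F \<Longrightarrow> v \<in> F \<Longrightarrow> u \<noteq> v \<Longrightarrow> \<epsilon> * l \<le> \<rho> u v" for x l F
  proof -
    let ?B = "qball \<rho> x (B * l)"
    have "0 < B * l" using K0 s l by (simp add: B_def)
    then obtain m where m: "emeasure \<mu> ?B = ennreal m" "0 < m"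
      using S.ball_pos[of "B * l" x] S.ball_finite[of "B * l" x] by (cases "emeasure \<mu> ?B") auto
    have disj: "disjoint_family_on (\<lambda>y. qball \<rho> y (s * l)) F"
      unfolding disjoint_family_on_def
    proof (intro ballI impI equals0I)
      fix u v w assume uv: "u \<in> F" "v \<in> F" "u \<noteq> v" "w \<in> qball \<rho> u (s * l) \<inter> qball \<rho> v (s * l)"
      have "\<rho> u v \<le> K\<^sub>0 * (\<rho> u w + \<rho> w v)" by (rule quasi_triangle)
      also have "\<dots> < K\<^sub>0 * (s * l + s * l)"
        using uv K0 by (intro mult_strict_left_mono add_strict_mono) (auto simp: qball_def sym)
      also have "\<dots> = \<epsilon> * l" using K0 by (simp add: s_def)
      finally show False using sep uv by force
    qed
    have sub: "qball \<rho> y (s * l) \<subseteq> ?B" if "y \<in> F" for y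
      using qball_shift[of x y l "s * l"] that F(2) by (force simp: qball_def B_def algebra_simps)
    have big: "emeasure \<mu> ?B \<le> ennreal D * emeasure \<mu> (qball \<rho> y (s * l))" if "y \<in> F" for y
    proof -
      have "?B \<subseteq> qball \<rho> y (K\<^sub>0 * (l + B * l))"
        using that F(2) by (intro qball_shift) (auto simp: qball_def sym)
      also have "K\<^sub>0 * (l + B * l) = (K\<^sub>0 * (1 + B) / s) * (s * l)"
        using s by (simp add: field_simps)
      finally have "emeasure \<mu> ?B \<le> emeasure \<mu> (qball \<rho> y ((K\<^sub>0 * (1 + B) / s) * (s * l)))"
        by (intro emeasure_mono ball_measurable)
      also have "\<dots> \<le> ennreal D * emeasure \<mu> (qball \<rho> y (s * l))"
        using s l by (intro D(2)) simp
      finally show ?thesis .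
    qed
    have "ennreal (real (card F) * m) = (\<Sum>y\<in>F. emeasure \<mu> ?B)"
      using m by (simp add: ennreal_mult ennreal_of_nat_eq_real_of_nat)
    also have "\<dots> \<le> (\<Sum>y\<in>F. ennreal D * emeasure \<mu> (qball \<rho> y (s * l)))"
      by (intro sum_mono big)
    also have "\<dots> = ennreal D * emeasure \<mu> (\<Union>y\<in>F. qball \<rho> y (s * l))"
      using disj F(1) ball_measurable
      by (subst sum_emeasure[symmetric]) (auto simp: sum_distrib_left)
    also have "\<dots> \<le> ennreal D * emeasure \<mu> ?B"
      using sub ball_measurable by (intro mult_left_mono emeasure_mono) auto
    also have "\<dots> = ennreal (D * m)" using m D by (simp add: ennreal_mult)
    finally have "real (card F) * m \<le> D * m"
      using m D by (subst (asm) ennreal_le_iff) auto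
    then have "real (card F) \<le> D" using m by simp
    then show ?thesis by (simp add: N_def) linarith
  qed
  show thesis
  proof (rule that)
    fix x and l :: real assume l: "0 < l"
    define \<F> where "\<F> = {F. finite F \<and> F \<subseteq> qball \<rho> x l \<and>
      (\<forall>u\<in>F. \<forall>v\<in>F. u \<noteq> v \<longrightarrow> \<epsilon> * l \<le> \<rho> u v)}"
    have "{} \<in> \<F>" by (simp add: \<F>_def)
    moreover have bdd: "card F \<le> N" if "F \<in> \<F>" for F
      using that l by (intro card_le[of l F x]) (auto simp: \<F>_def)
    ultimately obtain F where F: "F \<in> \<F>" "\<And>G. G \<in> \<F> \<Longrightarrow> card G \<le> card F"
      using ex_has_greatest_nat[of "\<lambda>F. F \<in> \<F>" "{}" card "Suc N"] by (metis less_Suc_eq_le)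
    have "qball \<rho> x l \<subseteq> (\<Union>y\<in>F. qball \<rho> y (\<epsilon> * l))"
    proof
      fix u assume u: "u \<in> qball \<rho> x l"
      show "u \<in> (\<Union>y\<in>F. qball \<rho> y (\<epsilon> * l))"
      proof (rule ccontr)
        assume "u \<notin> (\<Union>y\<in>F. qball \<rho> y (\<epsilon> * l))"
        then have far: "\<epsilon> * l \<le> \<rho> y u" if "y \<in> F" for y
          using that by (force simp: qball_def)
        have "u \<notin> F"
        proof
          assume "u \<in> F"
          then have "\<epsilon> * l \<le> \<rho> u u" by (rule far)
          then show False using eq_0_iff[of u u] mult_pos_pos[OF assms(2) l] by simp
        qed
        moreover have "insert u F \<in> \<F>"
          using F(1) u far sym by (auto simp: \<F>_def)
        then have "card (insert u F) \<le> card F" by (rule F(2))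
        moreover have "finite F" using F(1) by (simp add: \<F>_def)
        ultimately show False by simp
      qed
    qed
    then show "\<exists>F\<subseteq>qball \<rho> x l. finite F \<and> card F \<le> N \<and>
       qball \<rho> x l \<subseteq> (\<Union>y\<in>F. qball \<rho> y (\<epsilon> * l))"
      using F(1) bdd[OF F(1)] by (auto simp: \<F>_def)
  qed
qed

end


section \<open>From the weak type inequality to testing inequalities\<close>

text \<open>
  For a cube of time scale \<open>h\<close> and time intervals of length \<open>w\<close>, a step in time is admissible if
  it lies in \<open>[\<gamma> h + w, h - w]\<close>; this range has length comparable to \<open>h\<close>.
\<close>

lemma equal_time_steps:
  fixes \<gamma> h w d :: real
  assumes "0 \<le> \<gamma>" "\<gamma> < 1" "0 < h" "0 < w" "4 * w \<le> (1 - \<gamma>) * h" "2 * h \<le> (1 - \<gamma>) * d"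
  obtains n :: nat where "0 < n" "n \<le> nat \<lceil>2 * d / h\<rceil>"
    "\<gamma> * h + w \<le> d / n" "d / n \<le> h - w"
proof -
  define X where "X = h - w"
  define Y where "Y = \<gamma> * h + w"
  have "0 \<le> \<gamma> * h" using assms by simp
  moreover have "4 * w \<le> h - \<gamma> * h" using assms by (simp add: algebra_simps)
  ultimately have w: "4 * w \<le> h - \<gamma> * h" "4 * w \<le> h" by linarith+
  have X: "h / 2 \<le> X" "0 < X" "X \<le> h" using w assms by (auto simp: X_def)
  have Y: "0 < Y" "Y \<le> h" using w assms \<open>0 \<le> \<gamma> * h\<close> by (auto simp: Y_def)
  have XY: "(1 - \<gamma>) * h / 2 \<le> X - Y" 
  proof -
    have "(1 - \<gamma>) * h \<le> 2 * (X - Y)" using w by (simp add: X_def Y_def algebra_simps)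
    then show ?thesis by simp
  qed
  have d: "0 < d"
    using assms by (smt (verit) zero_less_mult_pos)
  define n where "n = nat \<lceil>d / X\<rceil>"
  have n: "d / X \<le> real n" "real n \<le> d / X + 1" "0 < n"
    using d X by (auto simp: n_def)
  have "d / X \<le> d / (h / 2)" using X d assms by (intro divide_left_mono) auto
  then have n_le: "n \<le> nat \<lceil>2 * d / h\<rceil>"
    unfolding n_def by (intro nat_mono ceiling_mono) (simp add: mult.commute)
  have "X * Y \<le> h * h" using X Y by (intro mult_mono) auto
  also have "\<dots> \<le> ((1 - \<gamma>) * d / 2) * h" using assms by (intro mult_right_mono) auto
  also have "\<dots> = d * ((1 - \<gamma>) * h / 2)" by simp
  also have "\<dots> \<le> d * (X - Y)" using XY d by (intro mult_left_mono) auto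
  finally have "(d / X + 1) * Y \<le> d" using X by (simp add: field_simps)
  then have "real n * Y \<le> d" using n(2) Y by (smt (verit) mult_right_mono)
  then have "Y \<le> d / n" using n(3) by (simp add: field_simps)
  moreover have "d / n \<le> X" using n X by (simp add: field_simps)
  ultimately show thesis using that n(3) n_le by (auto simp: X_def Y_def)
qed

locale weak_type_setting =
  homogeneous_type \<rho> K\<^sub>0 \<mu> C\<^sub>\<mu> + standing_assumptions \<rho> \<mu>
  for \<rho> :: "'a \<Rightarrow> 'a \<Rightarrow> real" and K\<^sub>0 :: real and \<mu> :: "'a measure" and C\<^sub>\<mu> :: real +
  fixes p q \<gamma> \<delta> :: real and K :: nat
    and I :: "nat \<Rightarrow> int \<Rightarrow> 'i set"
    and Q :: "nat \<Rightarrow> int \<Rightarrow> 'i \<Rightarrow> 'a set"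
    and \<omega> :: "'a \<times> real \<Rightarrow> real"
    and C\<^sub>w a b A :: real
  assumes geodesic: "monotone_geodesic \<rho>"
    and p: "1 < p" and q: "1 < q" and \<gamma>: "0 \<le> \<gamma>" "\<gamma> < 1" and \<delta>: "0 < \<delta>"
    and weight: "weight \<rho> \<mu> p \<omega>"
    and C\<^sub>w: "0 \<le> C\<^sub>w"
    and weak_bounded: "\<And>f. locally_integrable \<rho> \<mu> p f \<Longrightarrow> Lq_norm (par_measure \<mu>) \<omega> q f < \<infinity> \<Longrightarrow>
      weak_Lq_norm (par_measure \<mu>) \<omega> q (maximal_plus \<mu> p \<delta> K I Q \<gamma> f)
        \<le> ennreal C\<^sub>w * Lq_norm (par_measure \<mu>) \<omega> q f"
    and cube_constants: "0 < a" "0 < b" "0 < A"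
    and cubes: "\<And>x r. 0 < r \<Longrightarrow> \<exists>\<tau>\<in>{1..K}. \<exists>k. \<exists>\<alpha>\<in>I \<tau> k. Q \<tau> k \<alpha> \<in> sets \<mu> \<and>
       qball \<rho> x r \<subseteq> Q \<tau> k \<alpha> \<and> Q \<tau> k \<alpha> \<subseteq> qball \<rho> x (A * r) \<and>
       a * r \<le> \<delta> powi k \<and> \<delta> powi k \<le> b * r"
begin

abbreviation M :: "('a \<times> real) measure" where "M \<equiv> par_measure \<mu>"

abbreviation W :: "('a \<times> real) set \<Rightarrow> ennreal" where "W \<equiv> weighted_measure M \<omega>"

lemma space_M: "space M = UNIV"
  by (simp add: par_measure_def space_pair_measure space_eq)

lemma \<omega>_measurable: "\<omega> \<in> borel_measurable M"
  using weight by (simp add: weight_def locally_integrable_def)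

lemma \<omega>_pos: "AE w in M. 0 < \<omega> w"
  using weight by (simp add: weight_def)

lemma weighted_measure_le_of_maximal:
  assumes V: "V \<in> sets M" "emeasure M V < \<infinity>" and \<xi>: "0 < \<xi>"
    and f: "f \<in> borel_measurable M" "\<And>w. 0 \<le> f w" "\<And>w. f w \<le> B"
    and large: "\<And>u. u \<in> U \<Longrightarrow>
      ennreal \<xi> < maximal_plus \<mu> p \<delta> K I Q \<gamma> (\<lambda>w. f w * indicator V w) u"
  shows "W U \<le> ennreal ((C\<^sub>w / \<xi>) powr q + 1) * (\<integral>\<^sup>+w\<in>V. ennreal (f w powr q) * ennreal (\<omega> w) \<partial>M)"
proof -
  define g where "g w = f w * indicator V w" for w
  let ?F = "\<integral>\<^sup>+w\<in>V. ennreal (f w powr q) * ennreal (\<omega> w) \<partial>M"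
  have F: "(\<integral>\<^sup>+w. ennreal (\<bar>g w\<bar> powr q) * ennreal (\<omega> w) \<partial>M) = ?F"
    using f(2) q by (intro nn_integral_cong) (auto simp: g_def split: split_indicator)
  have "locally_integrable \<rho> \<mu> p g"
  proof -
    have B: "\<bar>f w\<bar> \<le> B" for w using f(2,3)[of w] by simp
    have "integrable M (\<lambda>w. indicator V w *\<^sub>R f w)"
      using V f(1) B by (intro integrableI_bounded_set_indicator[where B = B]) auto
    then have "integrable M g" by (simp add: g_def[abs_def] mult.commute)
    moreover have "cyl \<rho> p x t 1 \<in> sets M" for x t
      unfolding cyl_def by (intro par_measure_Times ball_measurable) simp
    ultimately have "set_integrable M (cyl \<rho> p x t 1) g" for x t
      unfolding set_integrable_def by (intro integrable_mult_indicator)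
    with \<open>integrable M g\<close> show ?thesis
      unfolding locally_integrable_def by (auto intro!: exI[of _ 1])
  qed
  note weak = weak_bounded[OF this]
  show ?thesis
  proof (cases ?F)
    case top
    have "0 < (C\<^sub>w / \<xi>) powr q + 1" by (smt (verit) powr_ge_zero)
    then show ?thesis using top by (simp add: ennreal_mult_top)
  next
    case (real c)
    have norm: "Lq_norm M \<omega> q g = ennreal (c powr (1 / q))"
      using real by (simp add: Lq_norm_def F epowr_ennreal)
    have "ennreal \<xi> * epowr (W U) (1 / q)
        \<le> ennreal \<xi> * epowr (W {w \<in> space M. ennreal \<xi> < maximal_plus \<mu> p \<delta> K I Q \<gamma> g w}) (1 / q)"
      unfolding weighted_measure_def using q large
      by (intro mult_left_mono epowr_mono nn_integral_mono)
        (auto simp: space_M g_def[abs_def] split: split_indicator)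
    also have "\<dots> \<le> weak_Lq_norm M \<omega> q (maximal_plus \<mu> p \<delta> K I Q \<gamma> g)"
      unfolding weak_Lq_norm_def using \<xi> by (intro SUP_upper) simp
    also have "\<dots> \<le> ennreal C\<^sub>w * ennreal (c powr (1 / q))"
      using weak by (simp add: norm)
    also have "\<dots> = ennreal \<xi> * ennreal ((C\<^sub>w / \<xi>) * c powr (1 / q))"
      using \<xi> C\<^sub>w by (simp flip: ennreal_mult)
    finally have "epowr (W U) (1 / q) \<le> ennreal ((C\<^sub>w / \<xi>) * c powr (1 / q))"
      using \<xi> by (subst (asm) ennreal_mult_le_mult_iff) auto
    then have "W U \<le> epowr (ennreal ((C\<^sub>w / \<xi>) * c powr (1 / q))) q"
      using q by (subst (asm) epowr_le_iff) auto
    also have "\<dots> = ennreal ((C\<^sub>w / \<xi>) powr q * c)"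
    proof -
      have "((C\<^sub>w / \<xi>) * c powr (1 / q)) powr q = (C\<^sub>w / \<xi>) powr q * (c powr (1 / q)) powr q"
        by (rule powr_mult)
      then show ?thesis using \<xi> C\<^sub>w q real by (simp add: epowr_ennreal powr_powr)
    qed
    also have "\<dots> \<le> ennreal (((C\<^sub>w / \<xi>) powr q + 1) * c)"
      using real by (intro ennreal_leI mult_right_mono) auto
    also have "\<dots> = ennreal ((C\<^sub>w / \<xi>) powr q + 1) * ?F"
      using real by (subst ennreal_mult) auto
    finally show ?thesis .
  qed
qed

lemma testing_in_cube:
  assumes cube: "\<tau> \<in> {1..K}" "\<alpha> \<in> I \<tau> k" "Q \<tau> k \<alpha> \<in> sets \<mu>"
    and V: "V \<in> sets \<mu>" "V \<subseteq> Q \<tau> k \<alpha>" and V': "V' \<subseteq> Q \<tau> k \<alpha>"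
    and J: "J \<in> sets lebesgue"
    and h: "h = (\<delta> powi k) powr p"
    and admissible: "\<And>s. s \<in> S \<Longrightarrow> J \<subseteq> {s + \<gamma> * h <..< s + h}"
    and pos: "0 < emeasure M (V \<times> J)" and fin: "emeasure M (V \<times> J) < \<infinity>"
    and D: "0 < D" "emeasure \<mu> (Q \<tau> k \<alpha>) * ennreal ((1 - \<gamma>) * h) \<le> ennreal D * emeasure M (V \<times> J)"
  shows "testing M q \<omega> ((2 * D * C\<^sub>w) powr q + 1) (V' \<times> S) (V \<times> J)"
  unfolding testing_def
proof (intro allI impI)
  fix f :: "'a \<times> real \<Rightarrow> real" and B
  assume f: "f \<in> borel_measurable M" "\<forall>w. 0 \<le> f w \<and> f w \<le> B"
    "emeasure M (V \<times> J) \<le> (\<integral>\<^sup>+w\<in>V \<times> J. ennreal (f w) \<partial>M)"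
  define g where "g w = f w * indicator (V \<times> J) w" for w
  have VJ: "V \<times> J \<in> sets M" using V J by (intro par_measure_Times)
  have large: "ennreal (1 / (2 * D)) < maximal_plus \<mu> p \<delta> K I Q \<gamma> g u" if u: "u \<in> V' \<times> S" for u
  proof -
    obtain x s where xs: "u = (x, s)" "x \<in> V'" "s \<in> S" using u by auto
    define P where "P = rect_plus p \<delta> Q \<gamma> \<tau> k \<alpha> s"
    have P_eq: "P = Q \<tau> k \<alpha> \<times> {s + \<gamma> * h <..< s + h}"
      using powi_powr_powr[OF \<delta>] by (simp add: P_def rect_plus_def h)
    have "0 \<le> h" by (simp add: h)
    have \<gamma>h: "\<gamma> * h \<le> h" using mult_right_mono[of \<gamma> 1 h] \<gamma> \<open>0 \<le> h\<close> by simp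
    have P: "P \<in> sets M" unfolding P_eq using cube by (intro par_measure_Times) auto
    have sub: "V \<times> J \<subseteq> P" using V admissible[OF xs(3)] by (auto simp: P_eq)
    have "emeasure M P = emeasure \<mu> (Q \<tau> k \<alpha>) * ennreal ((1 - \<gamma>) * h)"
      unfolding P_eq using cube \<gamma>h
      by (subst emeasure_par_measure_Times) (auto simp: algebra_simps)
    then have P_le: "emeasure M P \<le> ennreal D * emeasure M (V \<times> J)" using D by simp
    obtain v where v: "emeasure M (V \<times> J) = ennreal v" "0 < v"
      using pos fin by (cases "emeasure M (V \<times> J)") auto
    then have "emeasure M P \<le> ennreal (D * v)" using P_le D by (simp add: ennreal_mult)
    then obtain r where r: "emeasure M P = ennreal r" "0 \<le> r" "r \<le> D * v"
      using v D by (cases "emeasure M P") (auto simp: top_unique)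
    have "v \<le> r" using emeasure_mono[OF sub P] v r by simp
    have "1 / (2 * D) < v / r"
    proof -
      have "r < v * (2 * D)" using r(3) mult_pos_pos[OF D(1) v(2)] by (simp add: algebra_simps)
      then show ?thesis using D v \<open>v \<le> r\<close> by (simp add: field_simps)
    qed
    then have "ennreal (1 / (2 * D)) < ennreal (v / r)"
      using D by (intro ennreal_lessI) (auto intro: less_trans[of 0 "1 / (2 * D)"])
    also have "\<dots> = emeasure M (V \<times> J) / emeasure M P"
      using v r \<open>v \<le> r\<close> by (simp add: divide_ennreal)
    also have "\<dots> \<le> average M P (\<lambda>w. ennreal \<bar>g w\<bar>)"
      unfolding average_def
    proof (rule divide_right_mono_ennreal)
      have "(\<integral>\<^sup>+w\<in>V \<times> J. ennreal (f w) \<partial>M) \<le> (\<integral>\<^sup>+w\<in>P. ennreal \<bar>g w\<bar> \<partial>M)"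
        using sub by (intro nn_integral_mono) (auto simp: g_def split: split_indicator)
      with f(3) show "emeasure M (V \<times> J) \<le> (\<integral>\<^sup>+w\<in>P. ennreal \<bar>g w\<bar> \<partial>M)" by simp
    qed
    also have "\<dots> \<le> maximal_plus \<mu> p \<delta> K I Q \<gamma> g u"
      unfolding maximal_plus_def xs P_def using cube xs V'
      by (auto intro!: SUP_upper2[of "(\<tau>, k, \<alpha>)"])
    finally show ?thesis .
  qed
  show "W (V' \<times> S) \<le> ennreal ((2 * D * C\<^sub>w) powr q + 1) *
      (\<integral>\<^sup>+w\<in>V \<times> J. ennreal (f w powr q) * ennreal (\<omega> w) \<partial>M)"
    using weighted_measure_le_of_maximal[OF VJ fin, of "1 / (2 * D)" f B "V' \<times> S"] f(1,2) D large
    by (simp add: g_def[abs_def] mult.commute)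
qed

text \<open>
  A displacement in time that is large compared with \<open>r\<^sup>p\<close> is split into several steps inside one
  and the same cube; only the last of them also changes the ball.
\<close>

lemma testing_step:
  obtains D\<^sub>0 \<eta>\<^sub>0 where "0 < D\<^sub>0" "0 < \<eta>\<^sub>0"
    "\<And>\<eta> \<Lambda>. 0 < \<eta> \<Longrightarrow> \<eta> \<le> \<eta>\<^sub>0 \<Longrightarrow> \<exists>C\<ge>1. \<forall>r y y' s d. 0 < r \<longrightarrow> \<rho> y y' \<le> r \<longrightarrow>
       D\<^sub>0 * r powr p \<le> d \<longrightarrow> d \<le> \<Lambda> * r powr p \<longrightarrow>
       testing M q \<omega> C (qball \<rho> y r \<times> {s <.. s + \<eta> * r powr p})
         (qball \<rho> y' r \<times> {s + d <.. s + d + \<eta> * r powr p})"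
proof -
  have K0: "0 < K\<^sub>0" using K0_ge_1 by simp
  define a' where "a' = (2 * a * K\<^sub>0) powr p"
  define b' where "b' = (2 * b * K\<^sub>0) powr p"
  define D\<^sub>0 where "D\<^sub>0 = 2 * b' / (1 - \<gamma>)"
  define \<eta>\<^sub>0 where "\<eta>\<^sub>0 = (1 - \<gamma>) * a' / 4"
  have a': "0 < a'" and b': "0 < b'" using K0 cube_constants by (auto simp: a'_def b'_def)
  show thesis
  proof (rule that)
    show "0 < D\<^sub>0" "0 < \<eta>\<^sub>0" using a' b' \<gamma> by (auto simp: D\<^sub>0_def \<eta>\<^sub>0_def)
    fix \<eta> \<Lambda> assume \<eta>: "0 < \<eta>" "\<eta> \<le> \<eta>\<^sub>0"
    obtain D1 where D1: "1 \<le> D1" "\<And>x r. 0 < r \<Longrightarrow>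
        emeasure \<mu> (qball \<rho> x ((K\<^sub>0 * (1 + 2 * A * K\<^sub>0)) * r)) \<le> ennreal D1 * emeasure \<mu> (qball \<rho> x r)"
      using doubling_iterated by blast
    define D where "D = D1 * (1 - \<gamma>) * b' / \<eta>"
    have D: "0 < D" using D1 \<gamma> b' \<eta> by (simp add: D_def)
    define C1 where "C1 = (2 * D * C\<^sub>w) powr q + 1"
    define n\<^sub>0 where "n\<^sub>0 = nat \<lceil>2 * \<Lambda> / a'\<rceil>"
    have C1: "1 \<le> C1" by (simp add: C1_def)
    show "\<exists>C\<ge>1. \<forall>r y y' s d. 0 < r \<longrightarrow> \<rho> y y' \<le> r \<longrightarrow>
       D\<^sub>0 * r powr p \<le> d \<longrightarrow> d \<le> \<Lambda> * r powr p \<longrightarrow>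
       testing M q \<omega> C (qball \<rho> y r \<times> {s <.. s + \<eta> * r powr p})
         (qball \<rho> y' r \<times> {s + d <.. s + d + \<eta> * r powr p})"
    proof (intro exI[of _ "C1 ^ n\<^sub>0"] conjI allI impI)
      show "1 \<le> C1 ^ n\<^sub>0" using C1 by simp
      fix r y y' s d
      assume r: "0 < r" and yy': "\<rho> y y' \<le> r" and d: "D\<^sub>0 * r powr p \<le> d" "d \<le> \<Lambda> * r powr p"
      define w where "w = \<eta> * r powr p"
      have rp: "0 < r powr p" using r by simp
      have w: "0 < w" using \<eta> rp by (simp add: w_def)
      have "0 < 2 * K\<^sub>0 * r" using r K0 by simp
      from cubes[OF this, of y] obtain \<tau> k \<alpha> where cube: "\<tau> \<in> {1..K}" "\<alpha> \<in> I \<tau> k" "Q \<tau> k \<alpha> \<in> sets \<mu>"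
        and Q: "qball \<rho> y (2 * K\<^sub>0 * r) \<subseteq> Q \<tau> k \<alpha>" "Q \<tau> k \<alpha> \<subseteq> qball \<rho> y (A * (2 * K\<^sub>0 * r))"
        and dk: "a * (2 * K\<^sub>0 * r) \<le> \<delta> powi k" "\<delta> powi k \<le> b * (2 * K\<^sub>0 * r)"
        by blast
      define h where "h = (\<delta> powi k) powr p"
      have "0 < h" using \<delta> by (simp add: h_def)
      have h_lower: "a' * r powr p \<le> h"
      proof -
        have "a' * r powr p = (a * (2 * K\<^sub>0 * r)) powr p"
          using K0 r cube_constants by (simp add: a'_def powr_mult mult_ac)
        also have "\<dots> \<le> h" unfolding h_def using dk r K0 cube_constants p by (intro powr_mono2) auto
        finally show ?thesis .
      qed
      have h_upper: "h \<le> b' * r powr p"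
      proof -
        have "h \<le> (b * (2 * K\<^sub>0 * r)) powr p"
          unfolding h_def using dk \<delta> p by (intro powr_mono2) auto
        also have "\<dots> = b' * r powr p"
          using K0 r cube_constants by (simp add: b'_def powr_mult mult_ac)
        finally show ?thesis .
      qed
      have "4 * w \<le> (1 - \<gamma>) * h"
      proof -
        have "4 * w \<le> 4 * (\<eta>\<^sub>0 * r powr p)" using \<eta> rp by (simp add: w_def)
        also have "\<dots> = (1 - \<gamma>) * (a' * r powr p)" by (simp add: \<eta>\<^sub>0_def)
        also have "\<dots> \<le> (1 - \<gamma>) * h" using h_lower \<gamma> by (intro mult_left_mono) auto
        finally show ?thesis .
      qed
      moreover have "2 * h \<le> (1 - \<gamma>) * d"
      proof -
        have "2 * h \<le> (1 - \<gamma>) * (D\<^sub>0 * r powr p)" using h_upper \<gamma> by (simp add: D\<^sub>0_def)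
        also have "\<dots> \<le> (1 - \<gamma>) * d" using d \<gamma> by (intro mult_left_mono) auto
        finally show ?thesis .
      qed
      ultimately obtain n :: nat where n: "0 < n" "n \<le> nat \<lceil>2 * d / h\<rceil>"
          "\<gamma> * h + w \<le> d / n" "d / n \<le> h - w"
        using equal_time_steps[OF \<gamma> \<open>0 < h\<close> w] by blast
      have "n \<le> n\<^sub>0"
      proof -
        have "0 < D\<^sub>0 * r powr p" using \<open>0 < D\<^sub>0\<close> rp by simp
        then have "0 < d" using d(1) by simp
        then have "2 * d / h \<le> 2 * d / (a' * r powr p)"
          using h_lower a' rp \<open>0 < h\<close> by (intro divide_left_mono) auto
        also have "\<dots> \<le> 2 * (\<Lambda> * r powr p) / (a' * r powr p)"
          using d(2) a' rp by (intro divide_right_mono) auto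
        also have "\<dots> = 2 * \<Lambda> / a'" using rp by simp
        finally have "nat \<lceil>2 * d / h\<rceil> \<le> n\<^sub>0" unfolding n\<^sub>0_def by (intro nat_mono ceiling_mono)
        with n(2) show ?thesis by (rule order.trans)
      qed
      define e where "e = d / n"
      define Y where "Y i = (if i < n then y else y')" for i
      define U where "U i = qball \<rho> (Y i) r \<times> {s + real i * e <.. s + real i * e + w}" for i
      have Y: "\<rho> y (Y i) \<le> r" for i
        using yy' r eq_0_iff[of y y] by (simp add: Y_def)
      have Y_sub: "qball \<rho> (Y i) r \<subseteq> Q \<tau> k \<alpha>" for i
        using qball_shift[OF Y[of i], of r] Q(1) by (simp add: algebra_simps)
      have U_eq: "emeasure M (U i) = emeasure \<mu> (qball \<rho> (Y i) r) * ennreal w" for i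
        unfolding U_def using w ball_measurable by (subst emeasure_par_measure_Times) auto
      have "testing M q \<omega> (C1 ^ n) (U 0) (U n)"
      proof (rule testing_chain)
        fix i assume "i < n"
        then have Yi: "Y i = y" by (simp add: Y_def)
        let ?V = "qball \<rho> (Y (Suc i)) r"
        show "testing M q \<omega> C1 (U i) (U (Suc i))"
          unfolding C1_def U_def
        proof (rule testing_in_cube[OF cube ball_measurable Y_sub Y_sub _ h_def _ _ _ D])
          show "{s + real (Suc i) * e<..s + real (Suc i) * e + w} \<subseteq> {t + \<gamma> * h<..<t + h}"
            if "t \<in> {s + real i * e<..s + real i * e + w}" for t
            using that n(3,4) by (auto simp: e_def[symmetric] algebra_simps)
          show "0 < emeasure M (qball \<rho> (Y (Suc i)) r \<times> {s + real (Suc i) * e<..s + real (Suc i) * e + w})"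
            using U_eq[of "Suc i"] ball_pos[OF r] w unfolding U_def
            by (simp add: ennreal_zero_less_mult_iff)
          show "emeasure M (qball \<rho> (Y (Suc i)) r \<times> {s + real (Suc i) * e<..s + real (Suc i) * e + w}) < \<infinity>"
            using U_eq[of "Suc i"] ball_finite[OF r] unfolding U_def
            by (simp add: ennreal_mult_less_top)
          have "Q \<tau> k \<alpha> \<subseteq> qball \<rho> (Y (Suc i)) (K\<^sub>0 * (r + A * (2 * K\<^sub>0 * r)))"
            using Q(2) qball_shift[of "Y (Suc i)" y r "A * (2 * K\<^sub>0 * r)"] Y[of "Suc i"] sym by auto
          also have "K\<^sub>0 * (r + A * (2 * K\<^sub>0 * r)) = (K\<^sub>0 * (1 + 2 * A * K\<^sub>0)) * r"
            by (simp add: algebra_simps)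
          finally have "emeasure \<mu> (Q \<tau> k \<alpha>) \<le> emeasure \<mu> (qball \<rho> (Y (Suc i)) ((K\<^sub>0 * (1 + 2 * A * K\<^sub>0)) * r))"
            by (intro emeasure_mono ball_measurable)
          also have "\<dots> \<le> ennreal D1 * emeasure \<mu> ?V" by (rule D1(2)[OF r])
          finally have "emeasure \<mu> (Q \<tau> k \<alpha>) * ennreal ((1 - \<gamma>) * h)
              \<le> (ennreal D1 * emeasure \<mu> ?V) * ennreal ((1 - \<gamma>) * (b' * r powr p))"
            using h_upper \<gamma> by (intro mult_mono ennreal_leI mult_left_mono) auto
          also have "\<dots> = (ennreal D1 * ennreal ((1 - \<gamma>) * (b' * r powr p))) * emeasure \<mu> ?V"
            by (simp add: mult_ac)
          also have "ennreal D1 * ennreal ((1 - \<gamma>) * (b' * r powr p)) = ennreal D * ennreal w"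
            using D1 \<gamma> b' rp \<eta> D w by (simp add: D_def w_def flip: ennreal_mult)
          finally show "emeasure \<mu> (Q \<tau> k \<alpha>) * ennreal ((1 - \<gamma>) * h) \<le> ennreal D *
              emeasure M (?V \<times> {s + real (Suc i) * e<..s + real (Suc i) * e + w})"
            using U_eq[of "Suc i"] unfolding U_def by (simp add: mult_ac)
        qed simp
      next
        show "U i \<in> sets M" for i
          unfolding U_def by (intro par_measure_Times ball_measurable) simp
      qed (use C1 n in auto)
      moreover have "U 0 = qball \<rho> y r \<times> {s <.. s + w}" "U n = qball \<rho> y' r \<times> {s + d <.. s + d + w}"
        using n(1) by (simp_all add: U_def Y_def e_def)
      ultimately show "testing M q \<omega> (C1 ^ n\<^sub>0) (qball \<rho> y r \<times> {s <.. s + \<eta> * r powr p})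
         (qball \<rho> y' r \<times> {s + d <.. s + d + \<eta> * r powr p})"
        using testing_mono[of M q \<omega> "C1 ^ n"] power_increasing[OF \<open>n \<le> n\<^sub>0\<close> C1]
        by (simp add: w_def)
    qed
  qed
qed

end


section \<open>The Muckenhoupt condition\<close>

lemma weighted_measure_le_sum:
  assumes "E \<subseteq> (\<Union>i\<in>A. U i)" "finite A" "\<And>i. i \<in> A \<Longrightarrow> U i \<in> sets M" "f \<in> borel_measurable M"
  shows "weighted_measure M f E \<le> (\<Sum>i\<in>A. weighted_measure M f (U i))"
proof -
  have "weighted_measure M f E \<le> (\<integral>\<^sup>+w. (\<Sum>i\<in>A. ennreal (f w) * indicator (U i) w) \<partial>M)"
    unfolding weighted_measure_def
  proof (rule nn_integral_mono)
    fix w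
    show "ennreal (f w) * indicator E w \<le> (\<Sum>i\<in>A. ennreal (f w) * indicator (U i) w)"
    proof (cases "w \<in> E")
      case True
      then obtain i where i: "i \<in> A" "w \<in> U i" using assms(1) by auto
      then have "ennreal (f w) * indicator E w = ennreal (f w) * indicator (U i) w"
        using True by simp
      also have "\<dots> \<le> (\<Sum>i\<in>A. ennreal (f w) * indicator (U i) w)"
        using i assms(2) by (intro member_le_sum) auto
      finally show ?thesis .
    qed simp
  qed
  also have "\<dots> = (\<Sum>i\<in>A. weighted_measure M f (U i))"
    unfolding weighted_measure_def using assms
    by (intro nn_integral_sum) auto
  finally show ?thesis .
qed

lemma weighted_measure_le_card_times:
  assumes "E \<subseteq> (\<Union>i\<in>A. U i)" "finite A" "card A \<le> N" "A \<noteq> {}"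
    and "\<And>i. i \<in> A \<Longrightarrow> U i \<in> sets M" "f \<in> borel_measurable M"
  obtains i where "i \<in> A" "weighted_measure M f E \<le> ennreal (real N) * weighted_measure M f (U i)"
proof -
  let ?m = "\<lambda>i. weighted_measure M f (U i)"
  have "Max (?m ` A) \<in> ?m ` A" using assms(2,4) by (intro Max_in) auto
  then obtain i where i: "i \<in> A" "Max (?m ` A) = ?m i" by auto
  have "weighted_measure M f E \<le> (\<Sum>j\<in>A. ?m j)"
    using assms by (intro weighted_measure_le_sum)
  also have "\<dots> \<le> (\<Sum>j\<in>A. ?m i)"
    using assms(2) by (intro sum_mono) (simp add: i(2)[symmetric])
  also have "\<dots> = ennreal (real (card A)) * ?m i" by (simp add: ennreal_of_nat_eq_real_of_nat)
  also have "\<dots> \<le> ennreal (real N) * ?m i"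
    using assms(3) by (intro mult_right_mono ennreal_leI) auto
  finally show thesis using that i(1) by blast
qed

lemma weighted_product_le_of_cover:
  assumes E: "E \<subseteq> (\<Union>i\<in>A. U i)" "finite A" "card A \<le> N" "\<And>i. i \<in> A \<Longrightarrow> U i \<in> sets M"
    and F: "F \<subseteq> (\<Union>j\<in>B. V j)" "finite B" "card B \<le> N" "\<And>j. j \<in> B \<Longrightarrow> V j \<in> sets M"
    and f: "f \<in> borel_measurable M" and g: "g \<in> borel_measurable M" and s: "0 < s"
    and bound: "\<And>i j. i \<in> A \<Longrightarrow> j \<in> B \<Longrightarrow>
      weighted_measure M f (U i) * epowr (weighted_measure M g (V j)) s \<le> X"
  shows "weighted_measure M f E * epowr (weighted_measure M g F) s
    \<le> ennreal (real N * real N powr s) * X"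
proof (cases "A = {} \<or> B = {}")
  case True
  then have "weighted_measure M f E = 0 \<or> weighted_measure M g F = 0"
    using E(1) F(1) by (auto simp: weighted_measure_def)
  then show ?thesis using epowr_ennreal[of 0 s] by auto
next
  case False
  obtain i where i: "i \<in> A" "weighted_measure M f E \<le> ennreal (real N) * weighted_measure M f (U i)"
    using weighted_measure_le_card_times[OF E(1-3) _ E(4) f] False by auto
  obtain j where j: "j \<in> B" "weighted_measure M g F \<le> ennreal (real N) * weighted_measure M g (V j)"
    using weighted_measure_le_card_times[OF F(1-3) _ F(4) g] False by auto
  have "weighted_measure M f E * epowr (weighted_measure M g F) s
      \<le> (ennreal (real N) * weighted_measure M f (U i)) *
         epowr (ennreal (real N) * weighted_measure M g (V j)) s"
    by (intro mult_mono i(2) epowr_mono j(2) s) auto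
  also have "\<dots> = (ennreal (real N) * ennreal (real N powr s)) *
      (weighted_measure M f (U i) * epowr (weighted_measure M g (V j)) s)"
    using s by (simp add: epowr_mult epowr_ennreal mult_ac)
  also have "\<dots> \<le> (ennreal (real N) * ennreal (real N powr s)) * X"
    by (intro mult_left_mono bound i j) auto
  finally show ?thesis by (simp add: ennreal_mult)
qed

lemma half_open_subintervals_cover:
  fixes a w :: real
  assumes "0 < w" "u \<in> {a <.. a + real m * w}"
  shows "\<exists>i<m. u \<in> {a + real i * w <.. a + real i * w + w}"
proof -
  have ex: "u \<le> a + real m * w" using assms by simp
  define k where "k = (LEAST k. u \<le> a + real k * w)"
  have k: "u \<le> a + real k * w" "k \<le> m"
    unfolding k_def using ex by (auto intro: LeastI Least_le)
  have "k \<noteq> 0" using k(1) assms(2) by (intro notI) simp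
  then obtain i where i: "k = Suc i" by (cases k) auto
  have "\<not> u \<le> a + real i * w"
    using not_less_Least[of i "\<lambda>k. u \<le> a + real k * w"] i by (simp add: k_def)
  then show ?thesis using k i by (intro exI[of _ i]) (auto simp: algebra_simps)
qed

context weak_type_setting
begin

abbreviation \<sigma> :: "'a \<times> real \<Rightarrow> real" where
  "\<sigma> w \<equiv> \<omega> w powr (1 - conj_exponent q)"

lemma \<sigma>_measurable: "\<sigma> \<in> borel_measurable M"
  using \<omega>_measurable by measurable

lemma cyl_sets:
  "cyl_minus \<rho> p \<gamma> x t l \<in> sets M" "cyl_plus \<rho> p \<gamma> x t l \<in> sets M"
  unfolding cyl_minus_def cyl_plus_def by (intro par_measure_Times ball_measurable; simp)+

lemma emeasure_cyl:
  assumes "0 < l"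
  shows "emeasure M (cyl_minus \<rho> p \<gamma> x t l) = emeasure \<mu> (qball \<rho> x l) * ennreal ((1 - \<gamma>) * l powr p)"
    and "emeasure M (cyl_plus \<rho> p \<gamma> x t l) = emeasure \<mu> (qball \<rho> x l) * ennreal ((1 - \<gamma>) * l powr p)"
proof -
  have "\<gamma> * l powr p \<le> l powr p" using \<gamma> assms mult_right_mono[of \<gamma> 1 "l powr p"] by simp
  then show "emeasure M (cyl_minus \<rho> p \<gamma> x t l) = emeasure \<mu> (qball \<rho> x l) * ennreal ((1 - \<gamma>) * l powr p)"
    and "emeasure M (cyl_plus \<rho> p \<gamma> x t l) = emeasure \<mu> (qball \<rho> x l) * ennreal ((1 - \<gamma>) * l powr p)"
    unfolding cyl_minus_def cyl_plus_def using ball_measurable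
    by (auto simp: emeasure_par_measure_Times algebra_simps)
qed

lemma emeasure_cyl_pos_finite:
  assumes "0 < l"
  shows "0 < emeasure M (cyl_plus \<rho> p \<gamma> x t l)" "emeasure M (cyl_plus \<rho> p \<gamma> x t l) < \<infinity>"
  using ball_pos[OF assms, of x] ball_finite[OF assms, of x] \<gamma> assms
  by (auto simp: emeasure_cyl ennreal_zero_less_mult_iff ennreal_mult_less_top)

text \<open>
  Without time lag, a single cube whose time scale exceeds \<open>2 l\<^sup>p\<close> serves all points of the lower
  half of the cylinder simultaneously.
\<close>

lemma muckenhoupt_bound_no_lag:
  assumes "\<gamma> = 0"
  obtains E where "0 \<le> E" "\<And>x t l. 0 < l \<Longrightarrow>
    W (cyl_minus \<rho> p \<gamma> x t l) * epowr (weighted_measure M \<sigma> (cyl_plus \<rho> p \<gamma> x t l)) (q - 1)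
      \<le> ennreal E * epowr (emeasure M (cyl_plus \<rho> p \<gamma> x t l)) q"
proof -
  define R where "R = 1 + 2 / a"
  have R: "1 \<le> R" "2 \<le> a * R" using cube_constants by (auto simp: R_def field_simps)
  obtain D1 where D1: "1 \<le> D1" "\<And>x r. 0 < r \<Longrightarrow>
      emeasure \<mu> (qball \<rho> x ((A * R) * r)) \<le> ennreal D1 * emeasure \<mu> (qball \<rho> x r)"
    using doubling_iterated by blast
  define D where "D = D1 * (b * R) powr p"
  have D: "0 < D" using D1 cube_constants R by (simp add: D_def)
  define C where "C = (2 * D * C\<^sub>w) powr q + 1"
  have C: "0 \<le> C" by (simp add: C_def)
  have test: "testing M q \<omega> C (cyl_minus \<rho> p \<gamma> x t l) (cyl_plus \<rho> p \<gamma> x t l)" if l: "0 < l" for x t l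
  proof -
    have "0 < R * l" using R l by simp
    from cubes[OF this, of x] obtain \<tau> k \<alpha> where cube: "\<tau> \<in> {1..K}" "\<alpha> \<in> I \<tau> k" "Q \<tau> k \<alpha> \<in> sets \<mu>"
      and Q: "qball \<rho> x (R * l) \<subseteq> Q \<tau> k \<alpha>" "Q \<tau> k \<alpha> \<subseteq> qball \<rho> x (A * (R * l))"
      and dk: "a * (R * l) \<le> \<delta> powi k" "\<delta> powi k \<le> b * (R * l)"
      by blast
    define h where "h = (\<delta> powi k) powr p"
    have sub: "qball \<rho> x l \<subseteq> Q \<tau> k \<alpha>"
      using qball_mono[of l "R * l" x] Q(1) R l by auto
    have h_lower: "2 * l powr p \<le> h"
    proof -
      have "2 * l \<le> a * R * l" using R(2) l by (intro mult_right_mono) auto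
      also have "\<dots> \<le> \<delta> powi k" using dk(1) by (simp add: mult.assoc)
      finally have "2 * l \<le> \<delta> powi k" .
      have "2 powr 1 \<le> (2::real) powr p" using p by (intro powr_mono) auto
      then have "2 * l powr p \<le> 2 powr p * l powr p" by (intro mult_right_mono) auto
      also have "\<dots> = (2 * l) powr p" using l by (simp add: powr_mult)
      also have "\<dots> \<le> h"
        unfolding h_def using l p \<open>2 * l \<le> \<delta> powi k\<close> by (intro powr_mono2) auto
      finally show ?thesis .
    qed
    have h_upper: "h \<le> (b * R) powr p * l powr p"
    proof -
      have "h \<le> (b * R * l) powr p"
        unfolding h_def using dk \<delta> p by (intro powr_mono2) (auto simp: mult.assoc)
      then show ?thesis using cube_constants R l by (simp add: powr_mult)
    qed
    show ?thesis
      unfolding cyl_minus_def cyl_plus_def C_def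
    proof (rule testing_in_cube[OF cube ball_measurable sub sub _ h_def _ _ _ D])
      show "{t + \<gamma> * l powr p<..<t + l powr p} \<subseteq> {s + \<gamma> * h<..<s + h}"
        if "s \<in> {t - l powr p<..<t - \<gamma> * l powr p}" for s
        using that h_lower assms by auto
      show "0 < emeasure M (qball \<rho> x l \<times> {t + \<gamma> * l powr p<..<t + l powr p})"
        "emeasure M (qball \<rho> x l \<times> {t + \<gamma> * l powr p<..<t + l powr p}) < \<infinity>"
        using emeasure_cyl_pos_finite[OF l] by (auto simp: cyl_plus_def)
      have "emeasure \<mu> (Q \<tau> k \<alpha>) * ennreal ((1 - \<gamma>) * h)
          \<le> emeasure \<mu> (qball \<rho> x ((A * R) * l)) * ennreal ((b * R) powr p * l powr p)"
      proof (rule mult_mono)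
        show "emeasure \<mu> (Q \<tau> k \<alpha>) \<le> emeasure \<mu> (qball \<rho> x ((A * R) * l))"
          using Q(2) by (intro emeasure_mono ball_measurable) (simp add: mult.assoc)
        show "ennreal ((1 - \<gamma>) * h) \<le> ennreal ((b * R) powr p * l powr p)"
          using h_upper assms by (intro ennreal_leI) simp
      qed simp_all
      also have "\<dots> \<le> (ennreal D1 * emeasure \<mu> (qball \<rho> x l)) * ennreal ((b * R) powr p * l powr p)"
        by (intro mult_right_mono D1 l) simp
      also have "\<dots> = ennreal D * emeasure M (cyl_plus \<rho> p \<gamma> x t l)"
        using D1(1) assms emeasure_cyl(2)[OF l, of x t] by (simp add: D_def ennreal_mult mult_ac)
      finally show "emeasure \<mu> (Q \<tau> k \<alpha>) * ennreal ((1 - \<gamma>) * h)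
          \<le> ennreal D * emeasure M (qball \<rho> x l \<times> {t + \<gamma> * l powr p<..<t + l powr p})"
        by (simp add: cyl_plus_def)
    qed simp
  qed
  show thesis
  proof (rule that[OF C])
    fix x t and l :: real assume "0 < l"
    then show "W (cyl_minus \<rho> p \<gamma> x t l) *
        epowr (weighted_measure M \<sigma> (cyl_plus \<rho> p \<gamma> x t l)) (q - 1)
      \<le> ennreal C * epowr (emeasure M (cyl_plus \<rho> p \<gamma> x t l)) q"
      unfolding weighted_measure_def[of M \<sigma>]
      by (intro testing_dual test q C cyl_sets emeasure_cyl_pos_finite \<omega>_measurable \<omega>_pos)
  qed
qed

lemma testing_across_lag:
  assumes "0 < \<gamma>"
  obtains \<epsilon> C and m :: nat where "0 < \<epsilon>" "1 \<le> C" "0 < m"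
    "\<And>l y y' s d. 0 < l \<Longrightarrow> \<rho> y y' \<le> 2 * K\<^sub>0 * l \<Longrightarrow>
       2 * \<gamma> * l powr p \<le> d \<Longrightarrow> d \<le> 2 * l powr p \<Longrightarrow>
       testing M q \<omega> C (qball \<rho> y (\<epsilon> * l) \<times> {s <.. s + (1 - \<gamma>) * l powr p / m})
         (qball \<rho> y' (\<epsilon> * l) \<times> {s + d <.. s + d + (1 - \<gamma>) * l powr p / m})"
proof -
  have K0: "0 < K\<^sub>0" using K0_ge_1 by simp
  obtain K' where K': "1 \<le> K'" and geo: "\<And>s x y. 0 < s \<Longrightarrow> s \<le> \<rho> x y \<Longrightarrow>
      \<exists>(m::nat) \<xi>. 0 < m \<and> real m * s \<le> \<rho> x y \<and> \<xi> 0 = x \<and> \<xi> m = y \<and>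
        (\<forall>i<m. \<rho> (\<xi> i) (\<xi> (Suc i)) \<le> K' * s)"
    using monotone_geodesic_chain[OF geodesic] by blast
  obtain D\<^sub>0 \<eta>\<^sub>0 where D\<^sub>0: "0 < D\<^sub>0" and \<eta>\<^sub>0: "0 < \<eta>\<^sub>0" and step:
    "\<And>\<eta> \<Lambda>. 0 < \<eta> \<Longrightarrow> \<eta> \<le> \<eta>\<^sub>0 \<Longrightarrow> \<exists>C\<ge>1. \<forall>r y y' s d. 0 < r \<longrightarrow> \<rho> y y' \<le> r \<longrightarrow>
       D\<^sub>0 * r powr p \<le> d \<longrightarrow> d \<le> \<Lambda> * r powr p \<longrightarrow>
       testing M q \<omega> C (qball \<rho> y r \<times> {s <.. s + \<eta> * r powr p})
         (qball \<rho> y' r \<times> {s + d <.. s + d + \<eta> * r powr p})"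
    by (rule testing_step) blast
  define B where "B = 2 * K\<^sub>0 * K'"
  have B: "0 < B" using K0 K' by (simp add: B_def)
  define \<epsilon> where "\<epsilon> = min ((2 * \<gamma> / D\<^sub>0) powr (1 / p)) ((2 * \<gamma> / (D\<^sub>0 * B)) powr (1 / (p - 1)))"
  have \<epsilon>: "0 < \<epsilon>" using assms D\<^sub>0 B by (simp add: \<epsilon>_def)
  have \<epsilon>1: "D\<^sub>0 * \<epsilon> powr p \<le> 2 * \<gamma>"
  proof -
    have "\<epsilon> powr p \<le> ((2 * \<gamma> / D\<^sub>0) powr (1 / p)) powr p"
      using \<epsilon> p by (intro powr_mono2) (auto simp: \<epsilon>_def)
    also have "\<dots> = 2 * \<gamma> / D\<^sub>0" using assms D\<^sub>0 p by (simp add: powr_powr)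
    finally show ?thesis using D\<^sub>0 by (simp add: field_simps)
  qed
  have \<epsilon>2: "B / \<epsilon> * (D\<^sub>0 * \<epsilon> powr p) \<le> 2 * \<gamma>"
  proof -
    have "\<epsilon> powr (p - 1) \<le> ((2 * \<gamma> / (D\<^sub>0 * B)) powr (1 / (p - 1))) powr (p - 1)"
      using \<epsilon> p by (intro powr_mono2) (auto simp: \<epsilon>_def)
    also have "\<dots> = 2 * \<gamma> / (D\<^sub>0 * B)" using assms D\<^sub>0 B p by (simp add: powr_powr)
    finally have "D\<^sub>0 * B * \<epsilon> powr (p - 1) \<le> 2 * \<gamma>" using D\<^sub>0 B by (simp add: field_simps)
    then show ?thesis using \<epsilon> by (simp add: powr_diff mult_ac)
  qed
  define m where "m = Suc (nat \<lceil>(1 - \<gamma>) / (\<eta>\<^sub>0 * \<epsilon> powr p)\<rceil>)"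
  have m: "(1 - \<gamma>) / (\<eta>\<^sub>0 * \<epsilon> powr p) \<le> real m" "0 < m" unfolding m_def by linarith+
  define \<eta> where "\<eta> = (1 - \<gamma>) / (real m * \<epsilon> powr p)"
  have \<eta>: "0 < \<eta>" "\<eta> \<le> \<eta>\<^sub>0"
    using m \<gamma> \<epsilon> \<eta>\<^sub>0 by (auto simp: \<eta>_def field_simps)
  define \<Lambda> where "\<Lambda> = 2 / \<epsilon> powr p"
  obtain C where C: "1 \<le> C" and test: "\<And>r y y' s d. 0 < r \<Longrightarrow> \<rho> y y' \<le> r \<Longrightarrow>
       D\<^sub>0 * r powr p \<le> d \<Longrightarrow> d \<le> \<Lambda> * r powr p \<Longrightarrow>
       testing M q \<omega> C (qball \<rho> y r \<times> {s <.. s + \<eta> * r powr p})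
         (qball \<rho> y' r \<times> {s + d <.. s + d + \<eta> * r powr p})"
    using step[OF \<eta>, of \<Lambda>] by blast
  define n\<^sub>0 where "n\<^sub>0 = Suc (nat \<lceil>B / \<epsilon>\<rceil>)"
  show thesis
  proof (rule that[OF \<epsilon> _ m(2), of "C ^ n\<^sub>0"])
    show "1 \<le> C ^ n\<^sub>0" using C by simp
    fix l y y' s d
    assume l: "0 < l" and yy': "\<rho> y y' \<le> 2 * K\<^sub>0 * l"
      and d: "2 * \<gamma> * l powr p \<le> d" "d \<le> 2 * l powr p"
    define r where "r = \<epsilon> * l"
    have r: "0 < r" using \<epsilon> l by (simp add: r_def)
    have rp: "r powr p = \<epsilon> powr p * l powr p" using \<epsilon> l by (simp add: r_def powr_mult)
    define w where "w = \<eta> * r powr p"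
    have w_eq: "w = (1 - \<gamma>) * l powr p / m" using \<epsilon> m by (simp add: w_def \<eta>_def rp)
    have "\<exists>(n::nat) \<xi>. 0 < n \<and> (n = 1 \<or> real n \<le> B / \<epsilon>) \<and> \<xi> 0 = y \<and> \<xi> n = y' \<and>
        (\<forall>i<n. \<rho> (\<xi> i) (\<xi> (Suc i)) \<le> r)"
    proof (cases "\<rho> y y' \<le> r")
      case True
      then show ?thesis
        by (intro exI[of _ 1] exI[of _ "\<lambda>i. if i = 0 then y else y'"]) auto
    next
      case False
      have "r / K' \<le> r" using mult_left_mono[OF K', of r] K' r by (simp add: field_simps)
      then have "0 < r / K'" "r / K' \<le> \<rho> y y'" using r K' False by auto
      from geo[OF this] obtain n :: nat and \<xi> where n: "0 < n" "real n * (r / K') \<le> \<rho> y y'"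
        "\<xi> 0 = y" "\<xi> n = y'" "\<forall>i<n. \<rho> (\<xi> i) (\<xi> (Suc i)) \<le> K' * (r / K')" by blast
      have "real n * (r / K') \<le> 2 * K\<^sub>0 * l" using n yy' by simp
      then have "real n \<le> B / \<epsilon>" using l \<epsilon> K' by (simp add: r_def B_def field_simps)
      then show ?thesis using n K' by (intro exI[of _ n] exI[of _ \<xi>]) auto
    qed
    then obtain n :: nat and \<xi> where n: "0 < n" "n = 1 \<or> real n \<le> B / \<epsilon>" "\<xi> 0 = y" "\<xi> n = y'"
      "\<forall>i<n. \<rho> (\<xi> i) (\<xi> (Suc i)) \<le> r" by (elim exE conjE)
    have "n \<le> n\<^sub>0" using n(2) unfolding n\<^sub>0_def by linarith
    define e where "e = d / n"
    have "real n * (D\<^sub>0 * \<epsilon> powr p) \<le> 2 * \<gamma>"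
      using n(2)
    proof
      assume "real n \<le> B / \<epsilon>"
      then have "real n * (D\<^sub>0 * \<epsilon> powr p) \<le> B / \<epsilon> * (D\<^sub>0 * \<epsilon> powr p)"
        using D\<^sub>0 by (intro mult_right_mono) auto
      then show ?thesis using \<epsilon>2 by simp
    qed (use \<epsilon>1 in simp)
    then have "real n * (D\<^sub>0 * \<epsilon> powr p) * l powr p \<le> 2 * \<gamma> * l powr p"
      by (intro mult_right_mono) auto
    then have e_lower: "D\<^sub>0 * r powr p \<le> e"
      using d(1) n(1) by (simp add: e_def rp field_simps)
    have "0 \<le> d" using d(1) \<gamma> by (smt (verit) mult_nonneg_nonneg powr_ge_zero)
    then have "e \<le> d" using n(1) mult_left_mono[of 1 "real n" d] by (simp add: e_def field_simps)
    then have e_upper: "e \<le> \<Lambda> * r powr p" using d(2) \<epsilon> by (simp add: \<Lambda>_def rp)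
    define U where "U i = qball \<rho> (\<xi> i) r \<times> {s + real i * e <.. s + real i * e + w}" for i
    have "testing M q \<omega> (C ^ n) (U 0) (U n)"
    proof (rule testing_chain)
      fix i assume "i < n"
      from test[OF r n(5)[rule_format, OF this] e_lower e_upper, of "s + real i * e"]
      show "testing M q \<omega> C (U i) (U (Suc i))"
        by (simp add: U_def w_def algebra_simps)
    next
      show "U i \<in> sets M" for i
        unfolding U_def by (intro par_measure_Times ball_measurable) simp
    qed (use C n in auto)
    moreover have "U 0 = qball \<rho> y r \<times> {s <.. s + w}" "U n = qball \<rho> y' r \<times> {s + d <.. s + d + w}"
      using n by (simp_all add: U_def e_def)
    ultimately show "testing M q \<omega> (C ^ n\<^sub>0)
        (qball \<rho> y (\<epsilon> * l) \<times> {s <.. s + (1 - \<gamma>) * l powr p / m})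
        (qball \<rho> y' (\<epsilon> * l) \<times> {s + d <.. s + d + (1 - \<gamma>) * l powr p / m})"
      using testing_mono[of M q \<omega> "C ^ n"] power_increasing[OF \<open>n \<le> n\<^sub>0\<close> C]
      by (simp flip: w_eq r_def)
  qed
qed

lemma muckenhoupt_bound_lag:
  assumes "0 < \<gamma>"
  obtains E where "0 \<le> E" "\<And>x t l. 0 < l \<Longrightarrow>
    W (cyl_minus \<rho> p \<gamma> x t l) * epowr (weighted_measure M \<sigma> (cyl_plus \<rho> p \<gamma> x t l)) (q - 1)
      \<le> ennreal E * epowr (emeasure M (cyl_plus \<rho> p \<gamma> x t l)) q"
proof -
  have K0: "0 < K\<^sub>0" using K0_ge_1 by simp
  obtain \<epsilon> C and m :: nat where \<epsilon>: "0 < \<epsilon>" and C: "1 \<le> C" and m: "0 < m" and test: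
    "\<And>l y y' s d. 0 < l \<Longrightarrow> \<rho> y y' \<le> 2 * K\<^sub>0 * l \<Longrightarrow>
       2 * \<gamma> * l powr p \<le> d \<Longrightarrow> d \<le> 2 * l powr p \<Longrightarrow>
       testing M q \<omega> C (qball \<rho> y (\<epsilon> * l) \<times> {s <.. s + (1 - \<gamma>) * l powr p / m})
         (qball \<rho> y' (\<epsilon> * l) \<times> {s + d <.. s + d + (1 - \<gamma>) * l powr p / m})"
    by (rule testing_across_lag[OF assms]) blast
  obtain N :: nat where cover: "\<And>x l. 0 < l \<Longrightarrow> \<exists>F\<subseteq>qball \<rho> x l. finite F \<and> card F \<le> N \<and>
       qball \<rho> x l \<subseteq> (\<Union>y\<in>F. qball \<rho> y (\<epsilon> * l))"
    using ball_finite_cover[OF standing_assumptions_axioms \<epsilon>] by blast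
  obtain D where D: "1 \<le> D" "\<And>x r. 0 < r \<Longrightarrow>
      emeasure \<mu> (qball \<rho> x ((K\<^sub>0 * (1 + \<epsilon>)) * r)) \<le> ennreal D * emeasure \<mu> (qball \<rho> x r)"
    using doubling_iterated by blast
  define n where "n = N * m"
  define E where "E = (real n * real n powr (q - 1)) * (C * D powr q)"
  have E: "0 \<le> E" using C by (simp add: E_def)
  show thesis
  proof (rule that[OF E])
    fix x t and l :: real assume l: "0 < l"
    obtain F where F: "F \<subseteq> qball \<rho> x l" "finite F" "card F \<le> N"
       "qball \<rho> x l \<subseteq> (\<Union>y\<in>F. qball \<rho> y (\<epsilon> * l))"
      using cover[OF l, of x] by blast
    let ?L = "l powr p"
    have L: "0 < ?L" using l by simp
    define w where "w = (1 - \<gamma>) * ?L / m"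
    have w: "0 < w" using \<gamma> L m by (simp add: w_def)
    have mw: "real m * w = (1 - \<gamma>) * ?L" using m by (simp add: w_def)
    have iw: "0 \<le> real i * w" "real i * w + w \<le> (1 - \<gamma>) * ?L" if "i < m" for i
    proof -
      have "real (Suc i) * w \<le> real m * w" using that w by (intro mult_right_mono) auto
      then show "real i * w + w \<le> (1 - \<gamma>) * ?L" unfolding mw by (simp add: distrib_right add.commute)
    qed (use w in simp)
    define box where "box s = (\<lambda>(y, i::nat). qball \<rho> y (\<epsilon> * l) \<times> {s + real i * w <.. s + real i * w + w})" for s
    have box_sets: "box s yi \<in> sets M" for s yi
      unfolding box_def by (cases yi) (auto intro!: par_measure_Times ball_measurable)
    have box_cover: "qball \<rho> x l \<times> {s <..< s + (1 - \<gamma>) * ?L} \<subseteq> (\<Union>yi\<in>F \<times> {..<m}. box s yi)" for s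
    proof
      fix v assume "v \<in> qball \<rho> x l \<times> {s <..< s + (1 - \<gamma>) * ?L}"
      then obtain y u where v: "v = (y, u)" "y \<in> qball \<rho> x l" "u \<in> {s <.. s + real m * w}"
        by (auto simp: mw)
      obtain i where "i < m" "u \<in> {s + real i * w <.. s + real i * w + w}"
        using half_open_subintervals_cover[OF w v(3)] by blast
      then show "v \<in> (\<Union>yi\<in>F \<times> {..<m}. box s yi)"
        using v F(4) by (auto simp: box_def)
    qed
    have "card (F \<times> {..<m}) \<le> n"
      using F(3) by (simp add: n_def card_cartesian_product)
    define X where "X = ennreal (C * D powr q) * epowr (emeasure M (cyl_plus \<rho> p \<gamma> x t l)) q"
    have "W (cyl_minus \<rho> p \<gamma> x t l) * epowr (weighted_measure M \<sigma> (cyl_plus \<rho> p \<gamma> x t l)) (q - 1)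
        \<le> ennreal (real n * real n powr (q - 1)) * X"
    proof (rule weighted_product_le_of_cover)
      show "cyl_minus \<rho> p \<gamma> x t l \<subseteq> (\<Union>yi\<in>F \<times> {..<m}. box (t - ?L) yi)"
        using box_cover[of "t - ?L"] by (simp add: cyl_minus_def algebra_simps)
      show "cyl_plus \<rho> p \<gamma> x t l \<subseteq> (\<Union>yi\<in>F \<times> {..<m}. box (t + \<gamma> * ?L) yi)"
        using box_cover[of "t + \<gamma> * ?L"] by (simp add: cyl_plus_def algebra_simps)
      fix yi yj assume "yi \<in> F \<times> {..<m}" "yj \<in> F \<times> {..<m}"
      then obtain y i y' j where y: "yi = (y, i)" "y \<in> F" "i < m" "yj = (y', j)" "y' \<in> F" "j < m"
        by auto
      let ?V = "box (t + \<gamma> * ?L) (y', j)"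
      define s where "s = t - ?L + real i * w"
      define d where "d = (t + \<gamma> * ?L + real j * w) - s"
      have "s + d = t + \<gamma> * ?L + real j * w" by (simp add: d_def)
      have xy': "\<rho> x y' \<le> l" using y F(1) by (auto simp: qball_def)
      have "\<rho> y y' \<le> K\<^sub>0 * (\<rho> y x + \<rho> x y')" by (rule quasi_triangle)
      also have "\<dots> \<le> K\<^sub>0 * (l + l)"
        using y F(1) K0 xy' by (intro mult_left_mono add_mono) (auto simp: qball_def sym)
      finally have "\<rho> y y' \<le> 2 * K\<^sub>0 * l" by simp
      moreover have "2 * \<gamma> * ?L \<le> d" "d \<le> 2 * ?L"
        using iw[OF y(3)] iw[OF y(6)] w
        unfolding d_def s_def left_diff_distrib mult.assoc mult_1 by linarith+
      ultimately have "testing M q \<omega> C (qball \<rho> y (\<epsilon> * l) \<times> {s <.. s + w})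
         (qball \<rho> y' (\<epsilon> * l) \<times> {s + d <.. s + d + w})"
        unfolding w_def by (intro test l)
      then have box_test: "testing M q \<omega> C (box (t - ?L) (y, i)) ?V"
        unfolding \<open>s + d = _\<close> by (simp add: box_def s_def)
      have V_eq: "emeasure M ?V = emeasure \<mu> (qball \<rho> y' (\<epsilon> * l)) * ennreal w"
        unfolding box_def using w ball_measurable by (simp add: emeasure_par_measure_Times)
      have el: "0 < \<epsilon> * l" using \<epsilon> l by simp
      have V_le: "emeasure M ?V \<le> ennreal D * emeasure M (cyl_plus \<rho> p \<gamma> x t l)"
      proof -
        have "qball \<rho> y' (\<epsilon> * l) \<subseteq> qball \<rho> x (K\<^sub>0 * (l + \<epsilon> * l))"
          using xy' by (rule qball_shift)
        also have "K\<^sub>0 * (l + \<epsilon> * l) = (K\<^sub>0 * (1 + \<epsilon>)) * l" by (simp add: algebra_simps)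
        finally have "emeasure \<mu> (qball \<rho> y' (\<epsilon> * l)) \<le> emeasure \<mu> (qball \<rho> x ((K\<^sub>0 * (1 + \<epsilon>)) * l))"
          by (intro emeasure_mono ball_measurable)
        also have "\<dots> \<le> ennreal D * emeasure \<mu> (qball \<rho> x l)" by (rule D(2)[OF l])
        finally have "emeasure M ?V \<le> (ennreal D * emeasure \<mu> (qball \<rho> x l)) * ennreal ((1 - \<gamma>) * ?L)"
          unfolding V_eq using iw[OF y(3)] by (intro mult_mono ennreal_leI) auto
        then show ?thesis by (simp add: emeasure_cyl[OF l] mult.assoc)
      qed
      have "W (box (t - ?L) yi) * epowr (weighted_measure M \<sigma> (box (t + \<gamma> * ?L) yj)) (q - 1)
          \<le> ennreal C * epowr (emeasure M ?V) q"
        unfolding y weighted_measure_def[of M \<sigma>]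
      proof (rule testing_dual[OF box_test q _ box_sets _ _ \<omega>_measurable \<omega>_pos])
        show "0 < emeasure M ?V" "emeasure M ?V < \<infinity>"
          using ball_pos[OF el, of y'] ball_finite[OF el, of y'] w
          by (auto simp: V_eq ennreal_zero_less_mult_iff ennreal_mult_less_top)
      qed (use C in simp)
      also have "\<dots> \<le> ennreal C * epowr (ennreal D * emeasure M (cyl_plus \<rho> p \<gamma> x t l)) q"
        using q by (intro mult_left_mono epowr_mono V_le) auto
      also have "\<dots> = X"
        using q D C by (simp add: X_def epowr_mult epowr_ennreal ennreal_mult mult.assoc)
      finally show "W (box (t - ?L) yi) * epowr (weighted_measure M \<sigma> (box (t + \<gamma> * ?L) yj)) (q - 1) \<le> X" .
    qed (use F(2) q box_sets \<omega>_measurable \<sigma>_measurable \<open>card (F \<times> {..<m}) \<le> n\<close> in auto)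
    also have "\<dots> = ennreal E * epowr (emeasure M (cyl_plus \<rho> p \<gamma> x t l)) q"
      using C by (simp add: E_def X_def ennreal_mult mult.assoc)
    finally show "W (cyl_minus \<rho> p \<gamma> x t l) * epowr (weighted_measure M \<sigma> (cyl_plus \<rho> p \<gamma> x t l)) (q - 1)
        \<le> ennreal E * epowr (emeasure M (cyl_plus \<rho> p \<gamma> x t l)) q" .
  qed
qed

lemma weight_in_A_plus: "\<omega> \<in> A_plus \<rho> \<mu> p q \<gamma>"
proof -
  obtain E where E: "0 \<le> E" "\<And>x t l. 0 < l \<Longrightarrow>
    W (cyl_minus \<rho> p \<gamma> x t l) * epowr (weighted_measure M \<sigma> (cyl_plus \<rho> p \<gamma> x t l)) (q - 1)
      \<le> ennreal E * epowr (emeasure M (cyl_plus \<rho> p \<gamma> x t l)) q"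
    using muckenhoupt_bound_no_lag muckenhoupt_bound_lag \<gamma>(1) by (metis less_eq_real_def)
  have "average M (cyl_minus \<rho> p \<gamma> x t l) (\<lambda>w. ennreal (\<omega> w)) *
      epowr (average M (cyl_plus \<rho> p \<gamma> x t l) (\<lambda>w. ennreal (\<sigma> w))) (q - 1) \<le> ennreal E"
    if l: "0 < l" for x t l
  proof -
    let ?w = "W (cyl_minus \<rho> p \<gamma> x t l)" and ?s = "weighted_measure M \<sigma> (cyl_plus \<rho> p \<gamma> x t l)"
    obtain v where v: "emeasure M (cyl_plus \<rho> p \<gamma> x t l) = ennreal v" "0 < v"
      using emeasure_cyl_pos_finite[OF l, of x t]
      by (cases "emeasure M (cyl_plus \<rho> p \<gamma> x t l)") auto
    have div: "u / ennreal v = ennreal (1 / v) * u" for u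
      using v(2) by (simp add: divide_ennreal_def inverse_ennreal mult.commute inverse_eq_divide)
    have "average M (cyl_minus \<rho> p \<gamma> x t l) (\<lambda>w. ennreal (\<omega> w)) *
        epowr (average M (cyl_plus \<rho> p \<gamma> x t l) (\<lambda>w. ennreal (\<sigma> w))) (q - 1)
      = (?w / ennreal v) * epowr (?s / ennreal v) (q - 1)"
      using v(1) by (simp add: average_def weighted_measure_def emeasure_cyl[OF l])
    also have "\<dots> = (ennreal (1 / v) * ennreal ((1 / v) powr (q - 1))) * (?w * epowr ?s (q - 1))"
      using q v(2) by (simp add: div epowr_mult epowr_ennreal mult_ac)
    also have "\<dots> \<le> (ennreal (1 / v) * ennreal ((1 / v) powr (q - 1))) * (ennreal E * ennreal (v powr q))"
      using E(2)[OF l, of x t] v by (intro mult_left_mono) (auto simp: epowr_ennreal)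
    also have "\<dots> = ennreal (1 / v * (1 / v) powr (q - 1) * (E * v powr q))"
      using v E(1) by (simp flip: ennreal_mult)
    also have "1 / v * (1 / v) powr (q - 1) * (E * v powr q) = E"
      using v(2) by (simp add: powr_divide powr_diff)
    finally show ?thesis .
  qed
  then have "(SUP x. SUP t. SUP l\<in>{0<..}.
      average M (cyl_minus \<rho> p \<gamma> x t l) (\<lambda>w. ennreal (\<omega> w)) *
      epowr (average M (cyl_plus \<rho> p \<gamma> x t l) (\<lambda>w. ennreal (\<sigma> w))) (q - 1)) \<le> ennreal E"
    by (intro SUP_least) auto
  then show ?thesis
    using weight unfolding A_plus_def by (auto intro: le_less_trans)
qed

end

theorem theorem5p5:
  fixes \<rho> :: "'a \<Rightarrow> 'a \<Rightarrow> real" and \<mu> :: "'a measure"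
    and K\<^sub>0 C\<^sub>\<mu> p \<delta> c\<^sub>0 C\<^sub>0 q \<gamma> :: real and K :: nat
    and I :: "nat \<Rightarrow> int \<Rightarrow> 'i set"
    and z :: "nat \<Rightarrow> int \<Rightarrow> 'i \<Rightarrow> 'a"
    and Q :: "nat \<Rightarrow> int \<Rightarrow> 'i \<Rightarrow> 'a set"
    and \<omega> :: "'a \<times> real \<Rightarrow> real"
  assumes "homogeneous_type \<rho> K\<^sub>0 \<mu> C\<^sub>\<mu>"
    and "standing_assumptions \<rho> \<mu>"
    and "monotone_geodesic \<rho>"
    and "1 < p"
    and "standing_assumptions (par_dist p \<rho>) (par_measure \<mu>)"
    and "adjacent_dyadic_systems \<rho> \<mu> K\<^sub>0 \<delta> c\<^sub>0 C\<^sub>0 K I z Q"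
    and "1 < q"
    and "0 \<le> \<gamma>" and "\<gamma> < 1"
    and "weight \<rho> \<mu> p \<omega>"
    and "maximal_plus_weak_bounded \<rho> \<mu> p \<delta> K I Q q \<gamma> \<omega>"
  shows "\<omega> \<in> A_plus \<rho> \<mu> p q \<gamma>"
proof -
  interpret H: homogeneous_type \<rho> K\<^sub>0 \<mu> C\<^sub>\<mu> by fact
  obtain a b A where cubes: "0 < a" "0 < b" "0 < A"
    "\<And>x r. 0 < r \<Longrightarrow> \<exists>\<tau>\<in>{1..K}. \<exists>k. \<exists>\<alpha>\<in>I \<tau> k. Q \<tau> k \<alpha> \<in> sets \<mu> \<and>
       qball \<rho> x r \<subseteq> Q \<tau> k \<alpha> \<and> Q \<tau> k \<alpha> \<subseteq> qball \<rho> x (A * r) \<and>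
       a * r \<le> \<delta> powi k \<and> \<delta> powi k \<le> b * r"
    by (rule H.ball_in_comparable_cube[OF assms(2,3,6)]) blast
  obtain C\<^sub>w where C\<^sub>w: "0 \<le> C\<^sub>w" "\<And>f. locally_integrable \<rho> \<mu> p f \<Longrightarrow>
      Lq_norm (par_measure \<mu>) \<omega> q f < \<infinity> \<Longrightarrow>
      weak_Lq_norm (par_measure \<mu>) \<omega> q (maximal_plus \<mu> p \<delta> K I Q \<gamma> f)
        \<le> ennreal C\<^sub>w * Lq_norm (par_measure \<mu>) \<omega> q f"
    using assms(11) unfolding maximal_plus_weak_bounded_def by blast
  interpret S: standing_assumptions \<rho> \<mu> by fact
  interpret weak_type_setting \<rho> K\<^sub>0 \<mu> C\<^sub>\<mu> p q \<gamma> \<delta> K I Q \<omega> C\<^sub>w a b A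
    by unfold_locales
      (use assms cubes C\<^sub>w adjacent_dyadic_systems.delta(1)[OF assms(6)] in blast)+
  show ?thesis by (rule weight_in_A_plus)
qed

end
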